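(* (Mackey formula) Let $R$ be a commutative unital ring, $G,H,K$ finite groups, $X$ a finite $G$-set, $Y$ a finite $H$-set and $Z$ a finite $K$-set. Let $\langle U,\beta,\alpha\rangle$ in $RB^{H,G}(Y,X)$ and $\langle V,\delta,\gamma\rangle$ in $RB^{K,H}(Z,Y)$ be generating elements such that $U=(H\times G)/D$ is a transitive $(H\times G)$-set and $V=(K\times H)/E$ is a transitive $(K\times H)$-set, for subgroups $D\leqslant H\times G$ and $E\leqslant K\times H$. Suppose also that $\beta(D)=\gamma(E)$ (the values at the trivial cosets $D\in U$ and $E\in V$). Let $H'=\mathrm{Stab}_H(\beta(D))$, let $A$ be the projection of $E$ on $H$ and $B$ the projection of $D$ on $H$. Then $$\langle V,\delta,\gamma\rangle\circ\langle U,\beta,\alpha\rangle=\sum_{h\in [A\backslash H'/ B]} \langle (K\times G) /(E*{}^{(h,1)}D),\,\hat{\delta}_h,\,\hat{\alpha}_h\rangle,$$ where $[A\backslash H'/B]$ is a set of representatives of the double cosets of $A$ and $B$ in $H'$, $$E*{}^{(h,1)}D=\left\{(k,g)\in K\times G\mid \exists h'\in H \text{ such that } (k,h')\in E,\ (h',g)\in {}^{(h,1)} D\right\},$$ and, letting $T_h=E*{}^{(h,1)}D$, the maps are $\hat{\delta}_h((k,g)T_h)=k\delta(E)$ and $\hat{\alpha}_h((k,g)T_h)=g\alpha(D)$.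
   Context: ${}^{(h,1)}D=(h,1)D(h,1)^{-1}$ denotes conjugation in $H\times G$. All groups and sets with group action are finite; actions are left actions unless stated otherwise. For a finite group $\Gamma$ and a finite $\Gamma$-set $Z$, $B(Z)$ denotes the Grothendieck group, for the relations given by disjoint union, of the category of finite $\Gamma$-sets over $Z$ (pairs $(S,\varphi)$ with $\varphi:S\to Z$ a morphism of $\Gamma$-sets; isomorphisms are $\Gamma$-isomorphisms commuting with the maps to $Z$). The category $\mathscr{C}_R$: Objects are pairs $(G,X)$ with $G$ a finite group and $X$ a finite $G$-set, written $\frac{X}{G}$ or $X/G$. Morphisms: given $X/G$ and $Y/H$, regard $X$ and $Y$ as $(H\times G)$-sets through the projections ($H$ acts trivially on $X$, $G$ acts trivially on $Y$), and set $\mathrm{Hom}_{\mathscr{C}_R}(X/G,Y/H)=RB^{H,G}(Y,X):=R\otimes_{\mathbb Z}B(Y\times X)$, with $Y\times X$ viewed as an $(H\times G)$-set. It is generated by the classes $\langle U,\beta,\alpha\rangle$ of spans $Y\xleftarrow{\beta}U\xrightarrow{\alpha}X$ of $(H\times G)$-sets. An $(H\times G)$-set is identified with an $(H,G)$-biset through $(h,g)u=hug^{-1}$; so $\beta(hug)=h\beta(u)$ and $\alpha(hug)=g^{-1}\alpha(u)$. Composition: for $\langle U,\beta,\alpha\rangle\in RB^{H,G}(Y,X)$ and $\langle V,\delta,\gamma\rangle\in RB^{K,H}(Z,Y)$, $\langle V,\delta,\gamma\rangle\circ\langle U,\beta,\alpha\rangle=\langle V\hat\times_HU,\hat\delta,\hat\alpha\rangle$,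 where $V\times_HU$ is the set of orbits $[v,u]$ of $V\times U$ under the right $H$-action $(v,u)\cdot h=(vh,h^{-1}u)$, $V\hat\times_HU=\{[v,u]\in V\times_HU\mid\gamma(v)=\beta(u)\}$ with the natural $(K\times G)$-action, $\hat\delta[v,u]=\delta(v)$, $\hat\alpha[v,u]=\alpha(u)$; this is extended $R$-bilinearly. *)

theory Defs
  imports "HOL-Algebra.Group_Action" "HOL-Algebra.Left_Coset"
    "HOL-Algebra.Free_Abelian_Groups" "HOL-Algebra.Module"
begin

section \<open>Finite sets with a group action, and sets over them\<close>

text \<open>A triple \<open>(G, X, a)\<close> is a \<open>G\<close>-set \<open>X\<close> with action \<open>a\<close>; it is also the object \<open>X/G\<close> of
  the category.\<close>

type_synonym ('g, 'x) gset = "'g monoid \<times> 'x set \<times> ('g \<Rightarrow> 'x \<Rightarrow> 'x)"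

fun fin_gset :: "('g, 'x) gset \<Rightarrow> bool" where
  "fin_gset (G, X, a) \<longleftrightarrow>
     group G \<and> finite (carrier G) \<and> finite X \<and> group_action G X a"

text \<open>A triple \<open>(S, a, f)\<close> is a set \<open>S\<close> with action \<open>a\<close> and structure map \<open>f\<close> to a base.\<close>

type_synonym ('g, 's, 'z) over = "'s set \<times> ('g \<Rightarrow> 's \<Rightarrow> 's) \<times> ('s \<Rightarrow> 'z)"

fun gset_over :: "('g, 'z) gset \<Rightarrow> ('g, 's, 'z) over \<Rightarrow> bool" where
  "gset_over (G, Z, c) (S, a, f) \<longleftrightarrow>
     finite S \<and> group_action G S a \<and> f \<in> S \<rightarrow> Z \<and>
     (\<forall>g\<in>carrier G. \<forall>s\<in>S. f (a g s) = c g (f s))"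

fun iso_over :: "('g, 'z) gset \<Rightarrow> ('g, 's, 'z) over \<Rightarrow> ('g, 't, 'z) over \<Rightarrow> bool" where
  "iso_over (G, Z, c) (S, a, f) (T, b, k) \<longleftrightarrow>
     (\<exists>\<theta>. bij_betw \<theta> S T \<and>
          (\<forall>g\<in>carrier G. \<forall>s\<in>S. \<theta> (a g s) = b g (\<theta> s)) \<and>
          (\<forall>s\<in>S. k (\<theta> s) = f s))"

fun coprod_over :: "('g, 's, 'z) over \<Rightarrow> ('g, 't, 'z) over \<Rightarrow> ('g, 's + 't, 'z) over" where
  "coprod_over (S, a, f) (T, b, k) =
     (S <+> T, (\<lambda>g. \<lambda>x\<in>S <+> T. map_sum (a g) (b g) x), case_sum f k)"

text \<open>The members of an isomorphism class are only taken with underlying set in \<^typ>\<open>nat\<close>, so that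
  the class is a set. Every finite set over the base, of whatever type, is isomorphic to such a
  one, so nothing is lost.\<close>

definition iso_class :: "('g, 'z) gset \<Rightarrow> ('g, 's, 'z) over \<Rightarrow> ('g, nat, 'z) over set" where
  "iso_class Z S = {T. gset_over Z T \<and> iso_over Z T S}"


section \<open>The Grothendieck group \<open>B(Z)\<close>\<close>

type_synonym ('g, 'z) formal_sum = "('g, nat, 'z) over set \<Rightarrow>\<^sub>0 int"

definition free_classes :: "('g, 'z) gset \<Rightarrow> ('g, 'z) formal_sum monoid" where
  "free_classes Z =
     free_Abelian_group {iso_class Z S | S :: ('g, nat, 'z) over. gset_over Z S}"

definition coprod_relations :: "('g, 'z) gset \<Rightarrow> ('g, 'z) formal_sum set" where
  "coprod_relations Z = generate (free_classes Z)
     {frag_of (iso_class Z (coprod_over S T)) - frag_of (iso_class Z S) - frag_of (iso_class Z T)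
      | (S :: ('g, nat, 'z) over) (T :: ('g, nat, 'z) over). gset_over Z S \<and> gset_over Z T}"

definition burnside :: "('g, 'z) gset \<Rightarrow> ('g, 'z) formal_sum set monoid" where
  "burnside Z = free_classes Z Mod coprod_relations Z"

definition burnside_class :: "('g, 'z) gset \<Rightarrow> ('g, 's, 'z) over \<Rightarrow> ('g, 'z) formal_sum set" where
  "burnside_class Z S =
     coprod_relations Z #>\<^bsub>free_classes Z\<^esub> frag_of (iso_class Z S)"


section \<open>Extension of scalars \<open>R \<otimes>\<^sub>\<int> B\<close>\<close>

text \<open>Here \<open>B\<close> is a multiplicatively written abelian group.\<close>

definition free_pairs :: "'r ring \<Rightarrow> 'b monoid \<Rightarrow> ('r \<times> 'b \<Rightarrow>\<^sub>0 int) monoid" where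
  "free_pairs R B = free_Abelian_group (carrier R \<times> carrier B)"

definition tensor_relations :: "'r ring \<Rightarrow> 'b monoid \<Rightarrow> ('r \<times> 'b \<Rightarrow>\<^sub>0 int) set" where
  "tensor_relations R B = generate (free_pairs R B)
     ({frag_of (r \<oplus>\<^bsub>R\<^esub> s, b) - frag_of (r, b) - frag_of (s, b)
       | r s b. r \<in> carrier R \<and> s \<in> carrier R \<and> b \<in> carrier B} \<union>
      {frag_of (r, b \<otimes>\<^bsub>B\<^esub> c) - frag_of (r, b) - frag_of (r, c)
       | r b c. r \<in> carrier R \<and> b \<in> carrier B \<and> c \<in> carrier B})"

definition pure_tensor :: "'r ring \<Rightarrow> 'b monoid \<Rightarrow> 'r \<Rightarrow> 'b \<Rightarrow> ('r \<times> 'b \<Rightarrow>\<^sub>0 int) set" where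
  "pure_tensor R B r b = tensor_relations R B #>\<^bsub>free_pairs R B\<^esub> frag_of (r, b)"

text \<open>The scalar action is induced by \<open>r \<cdot> (s \<otimes> b) = rs \<otimes> b\<close>; the cosets united there all coincide.
  The fields \<^const>\<open>monoid.mult\<close> and \<^const>\<open>monoid.one\<close> of the module record carry no meaning.\<close>

definition scalar_ext :: "'r ring \<Rightarrow> 'b monoid \<Rightarrow> ('r, ('r \<times> 'b \<Rightarrow>\<^sub>0 int) set) module" where
  "scalar_ext R B =
     \<lparr>carrier = carrier (free_pairs R B Mod tensor_relations R B),
      monoid.mult = undefined,
      one = undefined,
      zero = \<one>\<^bsub>free_pairs R B Mod tensor_relations R B\<^esub>,
      add = (\<otimes>\<^bsub>free_pairs R B Mod tensor_relations R B\<^esub>),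
      smult = (\<lambda>r M. \<Union>m\<in>M. tensor_relations R B #>\<^bsub>free_pairs R B\<^esub>
                 frag_extend (\<lambda>(s, b). frag_of (r \<otimes>\<^bsub>R\<^esub> s, b)) m)\<rparr>"


section \<open>The category \<open>\<C>\<^sub>R\<close>\<close>

fun prod_gset :: "('h, 'y) gset \<Rightarrow> ('g, 'x) gset \<Rightarrow> ('h \<times> 'g, 'y \<times> 'x) gset" where
  "prod_gset (H, Y, b) (G, X, a) =
     (H \<times>\<times> G, Y \<times> X, \<lambda>(h, g). \<lambda>(y, x)\<in>Y \<times> X. (b h y, a g x))"

type_synonym ('r, 'h, 'g, 'y, 'x) hom_elt =
  "('r \<times> ('h \<times> 'g, 'y \<times> 'x) formal_sum set \<Rightarrow>\<^sub>0 int) set"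

text \<open>\<open>Hom_CR R \<X> \<Y>\<close> is the set of morphisms from \<open>\<X> = X/G\<close> to \<open>\<Y> = Y/H\<close>, that is
  \<open>RB\<^bsup>H,G\<^esup>(Y,X)\<close>.\<close>

definition Hom_CR ::
  "'r ring \<Rightarrow> ('g, 'x) gset \<Rightarrow> ('h, 'y) gset \<Rightarrow> ('r, ('r, 'h, 'g, 'y, 'x) hom_elt) module" where
  "Hom_CR R \<X> \<Y> = scalar_ext R (burnside (prod_gset \<Y> \<X>))"

text \<open>A span of \<open>(H \<times> G)\<close>-sets from \<open>\<X>\<close> to \<open>\<Y>\<close>, with set \<open>U\<close>, action \<open>a\<close>, and legs \<open>\<beta>\<close> to \<open>Y\<close>
  and \<open>\<alpha>\<close> to \<open>X\<close>, is the same thing as an \<open>(H \<times> G)\<close>-set over \<open>Y \<times> X\<close>.\<close>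

definition span_over ::
  "'u set \<Rightarrow> ('h \<times> 'g \<Rightarrow> 'u \<Rightarrow> 'u) \<Rightarrow> ('u \<Rightarrow> 'y) \<Rightarrow> ('u \<Rightarrow> 'x) \<Rightarrow> ('h \<times> 'g, 'u, 'y \<times> 'x) over" where
  "span_over U a \<beta> \<alpha> = (U, a, \<lambda>u. (\<beta> u, \<alpha> u))"

definition is_span ::
  "('g, 'x) gset \<Rightarrow> ('h, 'y) gset \<Rightarrow> 'u set \<Rightarrow> ('h \<times> 'g \<Rightarrow> 'u \<Rightarrow> 'u) \<Rightarrow>
   ('u \<Rightarrow> 'y) \<Rightarrow> ('u \<Rightarrow> 'x) \<Rightarrow> bool" where
  "is_span \<X> \<Y> U a \<beta> \<alpha> \<longleftrightarrow> gset_over (prod_gset \<Y> \<X>) (span_over U a \<beta> \<alpha>)"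

text \<open>The element \<open>\<langle>U, \<beta>, \<alpha>\<rangle>\<close> of \<open>RB\<^bsup>H,G\<^esup>(Y,X)\<close>.\<close>

definition span_class ::
  "'r ring \<Rightarrow> ('g, 'x) gset \<Rightarrow> ('h, 'y) gset \<Rightarrow> 'u set \<Rightarrow> ('h \<times> 'g \<Rightarrow> 'u \<Rightarrow> 'u) \<Rightarrow>
   ('u \<Rightarrow> 'y) \<Rightarrow> ('u \<Rightarrow> 'x) \<Rightarrow> ('r, 'h, 'g, 'y, 'x) hom_elt" where
  "span_class R \<X> \<Y> U a \<beta> \<alpha> =
     pure_tensor R (burnside (prod_gset \<Y> \<X>)) \<one>\<^bsub>R\<^esub>
       (burnside_class (prod_gset \<Y> \<X>) (span_over U a \<beta> \<alpha>))"


subsection \<open>Composition\<close>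

text \<open>Left actions of \<open>K \<times> H\<close> and \<open>H \<times> G\<close> are read as biset structures by \<open>k v h = (k, h\<^sup>-\<^sup>1) v\<close> and
  \<open>h u g = (h, g\<^sup>-\<^sup>1) u\<close>. In particular \<open>(k, g)\<close> sends \<open>[v, u]\<close> to \<open>[k v, u g\<^sup>-\<^sup>1]\<close>, and
  \<open>u g\<^sup>-\<^sup>1 = (1, g) u\<close>.\<close>

definition biset_orbit ::
  "'k monoid \<Rightarrow> 'h monoid \<Rightarrow> 'g monoid \<Rightarrow> ('k \<times> 'h \<Rightarrow> 'v \<Rightarrow> 'v) \<Rightarrow> ('h \<times> 'g \<Rightarrow> 'u \<Rightarrow> 'u) \<Rightarrow>
   'v \<times> 'u \<Rightarrow> ('v \<times> 'u) set" where
  "biset_orbit K H G b a = (\<lambda>(v, u).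
     {(b (\<one>\<^bsub>K\<^esub>, inv\<^bsub>H\<^esub> h) v, a (inv\<^bsub>H\<^esub> h, \<one>\<^bsub>G\<^esub>) u) | h. h \<in> carrier H})"

fun span_comp ::
  "'k monoid \<Rightarrow> 'h monoid \<Rightarrow> 'g monoid \<Rightarrow>
   ('k \<times> 'h, 'v, 'z \<times> 'y) over \<Rightarrow> ('h \<times> 'g, 'u, 'y \<times> 'x) over \<Rightarrow>
   ('k \<times> 'g, ('v \<times> 'u) set, 'z \<times> 'x) over" where
  "span_comp K H G (V, b, \<phi>) (U, a, \<psi>) =
     (let P = biset_orbit K H G b a ` {(v, u). v \<in> V \<and> u \<in> U \<and> snd (\<phi> v) = fst (\<psi> u)}
      in (P,
          (\<lambda>(k, g). \<lambda>Q\<in>P. (\<lambda>(v, u). (b (k, \<one>\<^bsub>H\<^esub>) v, a (\<one>\<^bsub>H\<^esub>, g) u)) ` Q),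
          (\<lambda>Q. the_elem ((\<lambda>(v, u). (fst (\<phi> v), snd (\<psi> u))) ` Q))))"

text \<open>The composition is extended from spans first biadditively to the groups \<open>B\<close> and then
  \<open>R\<close>-bilinearly to \<open>R \<otimes>\<^sub>\<int> B\<close>. At each level it is given on representatives; the classes united
  in a definition all coincide.\<close>

definition iso_class_comp ::
  "('g, 'x) gset \<Rightarrow> ('h, 'y) gset \<Rightarrow> ('k, 'z) gset \<Rightarrow>
   ('k \<times> 'h, nat, 'z \<times> 'y) over set \<Rightarrow> ('h \<times> 'g, nat, 'y \<times> 'x) over set \<Rightarrow>
   ('k \<times> 'g, nat, 'z \<times> 'x) over set" where
  "iso_class_comp \<X> \<Y> \<Z> I J =
     (\<Union>V\<in>I. \<Union>U\<in>J. iso_class (prod_gset \<Z> \<X>) (span_comp (fst \<Z>) (fst \<Y>) (fst \<X>) V U))"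

definition burnside_comp ::
  "('g, 'x) gset \<Rightarrow> ('h, 'y) gset \<Rightarrow> ('k, 'z) gset \<Rightarrow>
   ('k \<times> 'h, 'z \<times> 'y) formal_sum set \<Rightarrow> ('h \<times> 'g, 'y \<times> 'x) formal_sum set \<Rightarrow>
   ('k \<times> 'g, 'z \<times> 'x) formal_sum set" where
  "burnside_comp \<X> \<Y> \<Z> b b' =
     (\<Union>c\<in>b. \<Union>c'\<in>b'. coprod_relations (prod_gset \<Z> \<X>) #>\<^bsub>free_classes (prod_gset \<Z> \<X>)\<^esub>
        frag_extend (\<lambda>I. frag_extend (\<lambda>J. frag_of (iso_class_comp \<X> \<Y> \<Z> I J)) c') c)"

text \<open>\<open>comp_CR R \<X> \<Y> \<Z> M N\<close> is \<open>M \<circ> N\<close> for \<open>N\<close> from \<open>\<X>\<close> to \<open>\<Y>\<close> and \<open>M\<close> from \<open>\<Y>\<close> to \<open>\<Z>\<close>.\<close>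

definition comp_CR ::
  "'r ring \<Rightarrow> ('g, 'x) gset \<Rightarrow> ('h, 'y) gset \<Rightarrow> ('k, 'z) gset \<Rightarrow>
   ('r, 'k, 'h, 'z, 'y) hom_elt \<Rightarrow> ('r, 'h, 'g, 'y, 'x) hom_elt \<Rightarrow>
   ('r, 'k, 'g, 'z, 'x) hom_elt" where
  "comp_CR R \<X> \<Y> \<Z> M N =
     (let B = burnside (prod_gset \<Z> \<X>)
      in \<Union>m\<in>M. \<Union>n\<in>N. tensor_relations R B #>\<^bsub>free_pairs R B\<^esub>
           frag_extend (\<lambda>(r, b). frag_extend (\<lambda>(s, b').
             frag_of (r \<otimes>\<^bsub>R\<^esub> s, burnside_comp \<X> \<Y> \<Z> b b')) n) m)"


section \<open>Transitive sets, double cosets and the star product\<close>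

definition coset_act :: "'g monoid \<Rightarrow> 'g set \<Rightarrow> 'g \<Rightarrow> 'g set \<Rightarrow> 'g set" where
  "coset_act G D = (\<lambda>x. \<lambda>C\<in>lcosets\<^bsub>G\<^esub> D. x <#\<^bsub>G\<^esub> C)"

definition conj_subgroup :: "'g monoid \<Rightarrow> 'g \<Rightarrow> 'g set \<Rightarrow> 'g set" where
  "conj_subgroup G x D = x <#\<^bsub>G\<^esub> D #>\<^bsub>G\<^esub> inv\<^bsub>G\<^esub> x"

definition double_coset_reps :: "'h monoid \<Rightarrow> 'h set \<Rightarrow> 'h set \<Rightarrow> 'h set \<Rightarrow> 'h set \<Rightarrow> bool" where
  "double_coset_reps H A H' B S \<longleftrightarrow>
     S \<subseteq> H' \<and> (\<forall>C\<in>{A <#>\<^bsub>H\<^esub> {h} <#>\<^bsub>H\<^esub> B | h. h \<in> H'}. \<exists>!s. s \<in> S \<inter> C)"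

definition star_prod :: "'h monoid \<Rightarrow> 'k monoid \<Rightarrow> 'g monoid \<Rightarrow> ('k \<times> 'h) set \<Rightarrow> ('h \<times> 'g) set \<Rightarrow> ('k \<times> 'g) set" where
  "star_prod H K G E D =
     {(k, g) \<in> carrier K \<times> carrier G. \<exists>h\<in>carrier H. (k, h) \<in> E \<and> (h, g) \<in> D}"

text \<open>The maps \<open>(k, g) T \<mapsto> k z\<close> and \<open>(k, g) T \<mapsto> g x\<close> on left cosets of a subgroup \<open>T\<close> of \<open>K \<times> G\<close>,
  for actions \<open>c\<close> of \<open>K\<close> and \<open>a\<close> of \<open>G\<close>.\<close>

definition coset_map_fst :: "('k \<Rightarrow> 'z \<Rightarrow> 'z) \<Rightarrow> 'z \<Rightarrow> ('k \<times> 'g) set \<Rightarrow> 'z" where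
  "coset_map_fst c z C = the_elem ((\<lambda>(k, g). c k z) ` C)"

definition coset_map_snd :: "('g \<Rightarrow> 'x \<Rightarrow> 'x) \<Rightarrow> 'x \<Rightarrow> ('k \<times> 'g) set \<Rightarrow> 'x" where
  "coset_map_snd a x C = the_elem ((\<lambda>(k, g). a g x) ` C)"

end

theory Submission
  imports Defs
begin

text \<open>Every pair of cosets in the fibre product can be moved by \<open>H\<close> and \<open>K \<times> G\<close> to \<open>(E, (h, 1)D)\<close> with
  \<open>h \<in> H'\<close>. Two such points \<open>[E, (h, 1)D]\<close> and \<open>[E, (h', 1)D]\<close> lie in the same \<open>(K \<times> G)\<close>-orbit iff
  \<open>h \<in> A h' B\<close>, and the stabilizer of \<open>[E, (h, 1)D]\<close> is \<open>E * \<^sup>(\<^sup>h\<^sup>,\<^sup>1\<^sup>)D\<close>; so the orbit-stabilizer theorem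
  identifies the composite with a disjoint union of the required transitive sets. On the side of
  the morphism groups one needs that the composition of representatives respects the coproduct
  and tensor relations; both reduce to splitting a set over a base into invariant parts.\<close>

section \<open>Subgroups and cosets of free abelian groups\<close>

text \<open>All three levels of the composition are unions over representatives, so none of them can
  be evaluated before it is known that the united classes agree and that there is something to
  unite. The groups \<open>B\<close> and the tensor product are both quotients of free abelian
  groups by generated subgroups; hence one descent statement for biadditive maps,
  \<open>frag_extend2_cosets\<close>, serves twice, and only generators of the relations have to be
  tested. A second obstacle is the type of the underlying sets: relations and isomorphism classes
  speak of sets of naturals, while the given spans live on cosets and their composite on orbits of
  pairs of cosets. Composition is therefore studied for sets of arbitrary type and compared with
  naturals through isomorphisms. The group \<open>H'\<close> comes from the fibre condition: at
  \<open>(E, (h, 1)D)\<close> the two legs to \<open>Y\<close> take the values \<beta>(D) and h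
  \<beta>(D). A single criterion for one chosen point to be carried to another yields both the
  stabilizer, for equal points, and the double coset, for different ones.\<close>

lemma subgroup_free_zero: "subgroup N (free_Abelian_group S) \<Longrightarrow> 0 \<in> N"
  using subgroup.one_closed by fastforce

lemma subgroup_free_add:
  "subgroup N (free_Abelian_group S) \<Longrightarrow> x \<in> N \<Longrightarrow> y \<in> N \<Longrightarrow> x + y \<in> N"
  using subgroup.m_closed by fastforce

lemma subgroup_free_keys:
  "subgroup N (free_Abelian_group S) \<Longrightarrow> x \<in> N \<Longrightarrow> Poly_Mapping.keys x \<subseteq> S"
  using subgroup.mem_carrier by fastforce

lemma subgroup_free_uminus:
  assumes "subgroup N (free_Abelian_group S)" "x \<in> N"
  shows "- x \<in> N"
  using subgroup.m_inv_closed[OF assms] subgroup_free_keys[OF assms] by simp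

lemma subgroup_free_diff:
  assumes "subgroup N (free_Abelian_group S)" "x \<in> N" "y \<in> N"
  shows "x - y \<in> N"
  using subgroup_free_add[OF assms(1,2) subgroup_free_uminus[OF assms(1,3)]] by simp

lemma rcos_free: "N #>\<^bsub>free_Abelian_group S\<^esub> c = (\<lambda>n. n + c) ` N"
  by (auto simp: r_coset_def)

lemma rcos_free_iff: "d \<in> N #>\<^bsub>free_Abelian_group S\<^esub> c \<longleftrightarrow> d - c \<in> N"
  by (auto simp: rcos_free image_iff) (metis diff_add_cancel)

lemma rcos_free_eqI:
  assumes "subgroup N (free_Abelian_group S)" "x - y \<in> N"
  shows "N #>\<^bsub>free_Abelian_group S\<^esub> x = N #>\<^bsub>free_Abelian_group S\<^esub> y"
proof -
  have "d - x \<in> N \<longleftrightarrow> d - y \<in> N" for d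
    using subgroup_free_add[OF assms(1), of "d - x" "x - y"]
      subgroup_free_diff[OF assms(1), of "d - y" "x - y"] assms(2)
    by (auto simp: algebra_simps)
  then show ?thesis by (auto simp: rcos_free_iff)
qed

lemma rcos_free_self:
  "subgroup N (free_Abelian_group S) \<Longrightarrow> c \<in> N #>\<^bsub>free_Abelian_group S\<^esub> c"
  by (simp add: rcos_free_iff subgroup_free_zero)

lemma rcos_free_mult:
  assumes N: "subgroup N (free_Abelian_group S)"
  shows "(N #>\<^bsub>free_Abelian_group S\<^esub> x) <#>\<^bsub>free_Abelian_group S\<^esub> (N #>\<^bsub>free_Abelian_group S\<^esub> y)
    = N #>\<^bsub>free_Abelian_group S\<^esub> (x + y)" (is "?L = ?R")
proof
  show "?L \<subseteq> ?R"
  proof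
    fix d assume "d \<in> ?L"
    then obtain n m where "n \<in> N" "m \<in> N" "d = (n + x) + (m + y)"
      by (auto simp: set_mult_def rcos_free)
    then have "d = (n + m) + (x + y)" "n + m \<in> N"
      using subgroup_free_add[OF N] by auto
    then show "d \<in> ?R" by (auto simp: rcos_free)
  qed
  show "?R \<subseteq> ?L"
  proof
    fix d assume "d \<in> ?R"
    then obtain n where "n \<in> N" "d = (n + x) + (0 + y)"
      by (auto simp: rcos_free)
    then show "d \<in> ?L"
      using subgroup_free_zero[OF N] by (force simp: set_mult_def rcos_free)
  qed
qed

lemma subgroup_generate_free:
  "\<Gamma> \<subseteq> {x. Poly_Mapping.keys x \<subseteq> S} \<Longrightarrow>
     subgroup (generate (free_Abelian_group S) \<Gamma>) (free_Abelian_group S)"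
  by (rule group.generate_is_subgroup) auto

text \<open>Closure under differences together with \<open>P 0\<close> covers inverses, as
  \<open>0 - h\<close>, and sums, as \<open>h1 - (0 - h2)\<close>, so one case replaces two of
  \<open>generate.induct\<close>.\<close>

lemma generate_free_induct [consumes 2, case_names zero gen diff]:
  assumes "x \<in> generate (free_Abelian_group S) \<Gamma>"
    and \<Gamma>: "\<Gamma> \<subseteq> {x. Poly_Mapping.keys x \<subseteq> S}"
    and 0: "P 0" and gen: "\<And>r. r \<in> \<Gamma> \<Longrightarrow> P r" and diff: "\<And>r s. P r \<Longrightarrow> P s \<Longrightarrow> P (r - s)"
  shows "P x"
  using assms(1)
proof (induction rule: generate.induct)
  case one
  then show ?case by (simp add: 0)
next
  case (incl h)
  then show ?case by (rule gen)
next
  case (inv h)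
  then have "inv\<^bsub>free_Abelian_group S\<^esub> h = 0 - h" using \<Gamma> by auto
  then show ?case using diff[OF 0 gen[OF inv]] by simp
next
  case (eng h1 h2)
  then show ?case using diff[of h1 "0 - h2"] diff[OF 0, of h2] by simp
qed

lemma comm_group_Mod_free:
  "subgroup N (free_Abelian_group S) \<Longrightarrow> comm_group (free_Abelian_group S Mod N)"
  by (rule comm_group.abelian_FactGroup[OF abelian_free_Abelian_group])

lemma carrier_Mod_free:
  "carrier (free_Abelian_group S Mod N)
     = {N #>\<^bsub>free_Abelian_group S\<^esub> c | c. Poly_Mapping.keys c \<subseteq> S}"
  by (auto simp: carrier_FactGroup)

section \<open>Biadditive maps on free abelian groups and their descent to quotients\<close>

lemma frag_extend_fun_diff:
  "frag_extend (\<lambda>i. f i - g i) c = frag_extend f c - frag_extend g c"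
  by (rule frag_induction[of c UNIV]) (auto simp: frag_extend_diff)

text \<open>The biadditive extension of \<phi> from pairs of generators. The nesting, with
  \<open>c\<close> outside and \<open>d\<close> inside, is the one used in
  \<open>burnside_comp\<close> and \<open>comp_CR\<close>.\<close>

definition frag_extend2 ::
  "('a \<Rightarrow> 'b \<Rightarrow> 'c \<Rightarrow>\<^sub>0 int) \<Rightarrow> ('a \<Rightarrow>\<^sub>0 int) \<Rightarrow> ('b \<Rightarrow>\<^sub>0 int) \<Rightarrow> 'c \<Rightarrow>\<^sub>0 int" where
  "frag_extend2 \<phi> c d = frag_extend (\<lambda>i. frag_extend (\<phi> i) d) c"

lemma frag_extend2_of [simp]: "frag_extend2 \<phi> (frag_of i) (frag_of j) = \<phi> i j"
  by (simp add: frag_extend2_def)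

lemma frag_extend2_zero [simp]: "frag_extend2 \<phi> 0 d = 0" "frag_extend2 \<phi> c 0 = 0"
  by (simp_all add: frag_extend2_def frag_extend_eq_0)

text \<open>A difference in the inner argument turns into a difference of functions for the outer
  extension; \<open>frag_extend_fun_diff\<close> is there for this case.\<close>

lemma frag_extend2_diff:
  "frag_extend2 \<phi> (c - c') d = frag_extend2 \<phi> c d - frag_extend2 \<phi> c' d"
  "frag_extend2 \<phi> c (d - d') = frag_extend2 \<phi> c d - frag_extend2 \<phi> c d'"
  by (simp_all add: frag_extend2_def frag_extend_diff frag_extend_fun_diff)

lemma frag_extend2_add:
  "frag_extend2 \<phi> (c + c') d = frag_extend2 \<phi> c d + frag_extend2 \<phi> c' d"
  "frag_extend2 \<phi> c (d + d') = frag_extend2 \<phi> c d + frag_extend2 \<phi> c d'"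
  using frag_extend2_diff(1)[of \<phi> "c + c'" c' d] frag_extend2_diff(2)[of \<phi> c "d + d'" d']
  by (simp_all add: algebra_simps)

lemma keys_frag_extend2:
  assumes "\<And>i j. i \<in> A \<Longrightarrow> j \<in> B \<Longrightarrow> Poly_Mapping.keys (\<phi> i j) \<subseteq> C"
    and "Poly_Mapping.keys c \<subseteq> A" "Poly_Mapping.keys d \<subseteq> B"
  shows "Poly_Mapping.keys (frag_extend2 \<phi> c d) \<subseteq> C"
proof -
  have "Poly_Mapping.keys (frag_extend (\<phi> i) d) \<subseteq> C" if "i \<in> A" for i
    using keys_frag_extend[of "\<phi> i" d] assms(1)[OF that] assms(3) by blast
  then show ?thesis
    unfolding frag_extend2_def
    using keys_frag_extend[of "\<lambda>i. frag_extend (\<phi> i) d" c] assms(2) by blast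
qed

text \<open>The representatives are changed one at a time: \<phi>(c, d) - \<phi>(a, b) = \<phi>(c -
  a, d) + \<phi>(a, d - b), and each summand lies in \<open>N\<close> as soon as \<phi> sends every
  pair of a generating relation and a basis element into \<open>N\<close>. So all the united cosets
  are the same one.\<close>

lemma frag_extend2_cosets:
  assumes A: "NA = generate (free_Abelian_group A) \<Gamma>A" "\<Gamma>A \<subseteq> {x. Poly_Mapping.keys x \<subseteq> A}"
    and B: "NB = generate (free_Abelian_group B) \<Gamma>B" "\<Gamma>B \<subseteq> {x. Poly_Mapping.keys x \<subseteq> B}"
    and N: "subgroup N (free_Abelian_group C)"
    and left: "\<And>r j. r \<in> \<Gamma>A \<Longrightarrow> j \<in> B \<Longrightarrow> frag_extend2 \<phi> r (frag_of j) \<in> N"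
    and right: "\<And>i r. i \<in> A \<Longrightarrow> r \<in> \<Gamma>B \<Longrightarrow> frag_extend2 \<phi> (frag_of i) r \<in> N"
    and a: "Poly_Mapping.keys a \<subseteq> A" and b: "Poly_Mapping.keys b \<subseteq> B"
  shows "(\<Union>c\<in>NA #>\<^bsub>free_Abelian_group A\<^esub> a. \<Union>d\<in>NB #>\<^bsub>free_Abelian_group B\<^esub> b.
            N #>\<^bsub>free_Abelian_group C\<^esub> frag_extend2 \<phi> c d)
         = N #>\<^bsub>free_Abelian_group C\<^esub> frag_extend2 \<phi> a b"
proof -
  note NA = subgroup_generate_free[OF A(2), folded A(1)]
  note NB = subgroup_generate_free[OF B(2), folded B(1)]
  \<comment> \<open>Induction over the generation of \<open>n\<close> leaves a single generator, and
    induction over \<open>d\<close> then leaves a single basis element, which is the hypothesis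
    \<open>left\<close>.\<close>
  have l: "frag_extend2 \<phi> n d \<in> N" if n: "n \<in> NA" and d: "Poly_Mapping.keys d \<subseteq> B" for n d
    using n[unfolded A(1)] A(2)
  proof (induction rule: generate_free_induct)
    case (gen r)
    show ?case
      by (rule frag_induction[OF d])
        (auto simp: subgroup_free_zero[OF N] left gen frag_extend2_diff subgroup_free_diff[OF N])
  qed (auto simp: subgroup_free_zero[OF N] frag_extend2_diff subgroup_free_diff[OF N])
  have r: "frag_extend2 \<phi> c n \<in> N" if n: "n \<in> NB" and c: "Poly_Mapping.keys c \<subseteq> A" for n c
    using n[unfolded B(1)] B(2)
  proof (induction rule: generate_free_induct)
    case (gen r)
    show ?case
      by (rule frag_induction[OF c])
        (auto simp: subgroup_free_zero[OF N] right gen frag_extend2_diff subgroup_free_diff[OF N])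
  qed (auto simp: subgroup_free_zero[OF N] frag_extend2_diff subgroup_free_diff[OF N])
  have "N #>\<^bsub>free_Abelian_group C\<^esub> frag_extend2 \<phi> c d
      = N #>\<^bsub>free_Abelian_group C\<^esub> frag_extend2 \<phi> a b"
    if c: "c \<in> NA #>\<^bsub>free_Abelian_group A\<^esub> a" and d: "d \<in> NB #>\<^bsub>free_Abelian_group B\<^esub> b" for c d
  proof (rule rcos_free_eqI[OF N])
    have c': "c - a \<in> NA" and d': "d - b \<in> NB" using c d by (auto simp: rcos_free_iff)
    have "Poly_Mapping.keys d \<subseteq> B"
      using subgroup_free_keys[OF NB d'] b keys_add[of "d - b" b] by auto
    from l[OF c' this] r[OF d' a]
    have "frag_extend2 \<phi> (c - a) d + frag_extend2 \<phi> a (d - b) \<in> N"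
      by (rule subgroup_free_add[OF N])
    then show "frag_extend2 \<phi> c d - frag_extend2 \<phi> a b \<in> N"
      by (simp add: frag_extend2_diff)
  qed
  \<comment> \<open>The indices \<open>a\<close> and \<open>b\<close> themselves occur, so the union
    of equal cosets is not empty.\<close>
  then show ?thesis
    using rcos_free_self[OF NA, of a] rcos_free_self[OF NB, of b] by blast
qed

section \<open>Isomorphism classes of sets over a base\<close>

text \<open>This is \<^const>\<open>gset_over\<close> without the extensionality that \<^const>\<open>group_action\<close> imposes, so
  that it passes to invariant subsets with the same action.\<close>

fun acts_over :: "('g, 'z) gset \<Rightarrow> ('g, 's, 'z) over \<Rightarrow> bool" where
  "acts_over (G, Z, c) (S, a, f) \<longleftrightarrow>
     finite S \<and> (\<forall>g\<in>carrier G. \<forall>s\<in>S. a g s \<in> S) \<and> (\<forall>s\<in>S. a \<one>\<^bsub>G\<^esub> s = s) \<and>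
     (\<forall>g\<in>carrier G. \<forall>h\<in>carrier G. \<forall>s\<in>S. a (g \<otimes>\<^bsub>G\<^esub> h) s = a g (a h s)) \<and>
     f \<in> S \<rightarrow> Z \<and> (\<forall>g\<in>carrier G. \<forall>s\<in>S. f (a g s) = c g (f s))"

lemma acts_over_subset:
  assumes "acts_over (G, Z, c) (S, a, f)" "S' \<subseteq> S"
    and "\<And>g s. g \<in> carrier G \<Longrightarrow> s \<in> S' \<Longrightarrow> a g s \<in> S'"
  shows "acts_over (G, Z, c) (S', a, f)"
  using assms by (auto simp: Pi_iff subset_eq intro: finite_subset[OF assms(2)])

text \<open>A \<open>group_action\<close> is a homomorphism into \<open>BijGroup S\<close>, whose
  elements are extensional bijections of \<open>S\<close>. Bijectivity follows from the action laws,
  with the action of \<open>inv g\<close> as inverse, so extensionality is the whole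
  difference.\<close>

lemma gset_over_iff:
  fixes G (structure)
  assumes "group G"
  shows "gset_over (G, Z, c) (S, a, f) \<longleftrightarrow>
    acts_over (G, Z, c) (S, a, f) \<and> (\<forall>g\<in>carrier G. a g \<in> extensional S)" (is "?L \<longleftrightarrow> ?R")
proof
  interpret group G by fact
  show ?R if L: ?L
  proof -
    interpret group_action G S a using L by simp
    have "a g \<in> extensional S" if "g \<in> carrier G" for g
      using bij_prop0[OF that] by (simp add: Bij_def)
    moreover have "a \<one>\<^bsub>G\<^esub> s = s" if "s \<in> S" for s
      using id_eq_one that by (metis restrict_apply')
    moreover have "a (g \<otimes> h) s = a g (a h s)"
      if "g \<in> carrier G" "h \<in> carrier G" "s \<in> S" for g h s
      using composition_rule that by simp
    moreover have "a g s \<in> S" if "g \<in> carrier G" "s \<in> S" for g s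
      using element_image that by blast
    ultimately show ?thesis
      using L by simp
  qed
  show ?L if R: ?R
  proof -
    have bij: "a g \<in> Bij S" if g: "g \<in> carrier G" for g
    proof -
      have "bij_betw (a g) S S"
      proof (rule bij_betw_byWitness[where f' = "a (inv g)"])
        show "\<forall>s\<in>S. a (inv g) (a g s) = s" "\<forall>s\<in>S. a g (a (inv g) s) = s"
          using R g by (simp_all, metis inv_closed l_inv, metis inv_closed r_inv)
      qed (use R g in auto)
      then show ?thesis using R g by (simp add: Bij_def)
    qed
    have "a \<in> hom G (BijGroup S)"
    proof (rule homI)
      fix g assume "g \<in> carrier G"
      then show "a g \<in> carrier (BijGroup S)" by (simp add: BijGroup_def bij)
    next
      fix g h assume gh: "g \<in> carrier G" "h \<in> carrier G"
      have "a (g \<otimes> h) = compose S (a g) (a h)"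
        by (rule extensionalityI[where A = S])
          (use R gh in \<open>auto simp: compose_def\<close>)
      then show "a (g \<otimes> h) = a g \<otimes>\<^bsub>BijGroup S\<^esub> a h"
        by (simp add: BijGroup_def bij gh)
    qed
    then have "group_action G S a"
      by (simp add: group_action_def group_hom_def group_hom_axioms_def group_BijGroup is_group)
    then show ?thesis using R by auto
  qed
qed

lemma gset_over_acts: "group (fst Z) \<Longrightarrow> gset_over Z S \<Longrightarrow> acts_over Z S"
  by (cases Z; cases S) (simp add: gset_over_iff del: gset_over.simps acts_over.simps)

lemma iso_overI:
  assumes "bij_betw \<theta> S T"
    and "\<And>g s. g \<in> carrier G \<Longrightarrow> s \<in> S \<Longrightarrow> \<theta> (a g s) = b g (\<theta> s)"
    and "\<And>s. s \<in> S \<Longrightarrow> k (\<theta> s) = f s"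
  shows "iso_over (G, Z, c) (S, a, f) (T, b, k)"
  using assms by auto

lemma iso_over_trans:
  assumes "iso_over Z S T" "iso_over Z T U"
  shows "iso_over Z S U"
proof -
  obtain G z c where Z: "Z = (G, z, c)" by (metis prod_cases3)
  obtain S' a f where S: "S = (S', a, f)" by (metis prod_cases3)
  obtain T' b k where T: "T = (T', b, k)" by (metis prod_cases3)
  obtain U' d l where U: "U = (U', d, l)" by (metis prod_cases3)
  obtain \<theta> where \<theta>: "bij_betw \<theta> S' T'" "\<forall>g\<in>carrier G. \<forall>s\<in>S'. \<theta> (a g s) = b g (\<theta> s)"
    "\<forall>s\<in>S'. k (\<theta> s) = f s" using assms(1) by (auto simp: Z S T)
  obtain \<eta> where \<eta>: "bij_betw \<eta> T' U'" "\<forall>g\<in>carrier G. \<forall>s\<in>T'. \<eta> (b g s) = d g (\<eta> s)"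
    "\<forall>s\<in>T'. l (\<eta> s) = k s" using assms(2) by (auto simp: Z T U)
  show ?thesis unfolding Z S U
    by (rule iso_overI[where \<theta> = "\<eta> \<circ> \<theta>"])
      (use \<theta> \<eta> bij_betw_trans bij_betwE[OF \<theta>(1)] in \<open>auto\<close>)
qed

text \<open>The inverse is equivariant because b g (\<theta> s) = \<theta> (a g s) with a g s still
  in the source, where the inverse cancels \<theta>; \<open>acts_over\<close> supplies this
  closure.\<close>

lemma iso_over_sym:
  assumes "acts_over Z S" "iso_over Z S T"
  shows "iso_over Z T S"
proof -
  obtain G z c where Z: "Z = (G, z, c)" by (metis prod_cases3)
  obtain S' a f where S: "S = (S', a, f)" by (metis prod_cases3)
  obtain T' b k where T: "T = (T', b, k)" by (metis prod_cases3)
  obtain \<theta> where \<theta>: "bij_betw \<theta> S' T'" "\<forall>g\<in>carrier G. \<forall>s\<in>S'. \<theta> (a g s) = b g (\<theta> s)"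
    "\<forall>s\<in>S'. k (\<theta> s) = f s" using assms(2) by (auto simp: Z S T)
  have cl: "a g s \<in> S'" if "g \<in> carrier G" "s \<in> S'" for g s
    using assms(1) that by (auto simp: Z S)
  have inv: "inv_into S' \<theta> (\<theta> s) = s" if "s \<in> S'" for s
    using \<theta>(1) that by (simp add: bij_betw_def)
  have T': "T' = \<theta> ` S'" using \<theta>(1) by (simp add: bij_betw_def)
  show ?thesis unfolding Z S T
  proof (rule iso_overI[OF bij_betw_inv_into[OF \<theta>(1)]])
    fix g t assume gt: "g \<in> carrier G" "t \<in> T'"
    then obtain s where s: "s \<in> S'" "t = \<theta> s" using T' by blast
    then have "b g t = \<theta> (a g s)" using \<theta>(2) gt by simp
    then show "inv_into S' \<theta> (b g t) = a g (inv_into S' \<theta> t)"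
      by (simp add: inv cl s gt)
  next
    fix t assume "t \<in> T'"
    then show "f (inv_into S' \<theta> t) = k t" using T' \<theta>(3) inv by auto
  qed
qed

lemma iso_class_eqI:
  assumes "acts_over Z S" "iso_over Z S T"
  shows "iso_class Z S = iso_class Z T"
  using iso_over_trans[OF _ assms(2)] iso_over_trans[OF _ iso_over_sym[OF assms]]
  unfolding iso_class_def by blast

text \<open>An isomorphism onto \<open>S\<close> tests the action and the map only at points of
  \<open>S\<close>. This allows the restriction in \<open>span_comp\<close> to be dropped inside a
  class.\<close>

lemma iso_class_cong:
  assumes "\<And>g s. g \<in> carrier G \<Longrightarrow> s \<in> S \<Longrightarrow> a g s = b g s" "\<And>s. s \<in> S \<Longrightarrow> f s = k s"
  shows "iso_class (G, Z, c) (S, a, f) = iso_class (G, Z, c) (S, b, k)"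
proof -
  have "iso_over (G, Z, c) T (S, a, f) \<longleftrightarrow> iso_over (G, Z, c) T (S, b, k)" for T :: "(_, nat, _) over"
  proof -
    obtain T' d l where T: "T = (T', d, l)" by (metis prod_cases3)
    have "bij_betw \<theta> T' S \<Longrightarrow> t \<in> T' \<Longrightarrow> \<theta> t \<in> S" for \<theta> t using bij_betwE by blast
    then show ?thesis unfolding T iso_over.simps using assms by (metis (no_types, lifting))
  qed
  then show ?thesis by (simp add: iso_class_def)
qed

text \<open>Transport of structure along an enumeration of the finite set. It gives every set over
  the base, of whatever type, a representative on naturals, so that its class is nonempty and is one
  of the free generators.\<close>

lemma iso_class_rep:
  fixes S :: "('g, 's, 'z) over"
  assumes "group (fst Z)" "acts_over Z S"
  obtains T :: "('g, nat, 'z) over" where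
    "gset_over Z T" "iso_over Z T S" "iso_class Z T = iso_class Z S"
proof -
  obtain G z c where Z: "Z = (G, z, c)" by (metis prod_cases3)
  obtain S' a f where S: "S = (S', a, f)" by (metis prod_cases3)
  have acts: "acts_over (G, z, c) (S', a, f)" using assms by (simp only: Z S)
  then obtain \<theta> and n :: nat where \<theta>: "bij_betw \<theta> {..<n} S'"
    using ex_bij_betw_nat_finite[of S'] by (auto simp: lessThan_atLeast0)
  define \<eta> where "\<eta> = inv_into {..<n} \<theta>"
  \<comment> \<open>Cut off outside the initial segment, since \<open>group_action\<close> requires
    extensional maps.\<close>
  define d where "d = (\<lambda>g. \<lambda>t\<in>{..<n}. \<eta> (a g (\<theta> t)))"
  have \<theta>S: "\<theta> t \<in> S'" if "t < n" for t using \<theta> that bij_betwE by fastforce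
  have \<eta>n: "\<eta> s < n" "\<theta> (\<eta> s) = s" if "s \<in> S'" for s
    using \<theta> that unfolding \<eta>_def
    by (metis bij_betw_def inv_into_into lessThan_iff, metis bij_betw_def f_inv_into_f)
  have \<eta>\<theta>: "\<eta> (\<theta> t) = t" if "t < n" for t
    using \<theta> that by (simp add: \<eta>_def bij_betw_def)
  have "acts_over (G, z, c) ({..<n}, d, f \<circ> \<theta>)"
    using acts group.is_monoid[THEN monoid.m_closed] group.is_monoid[THEN monoid.one_closed] assms(1)
    by (auto simp: d_def \<theta>S \<eta>n \<eta>\<theta> Z)
  then have g: "gset_over Z ({..<n}, d, f \<circ> \<theta>)"
    using assms(1) by (auto simp: Z gset_over_iff d_def simp del: gset_over.simps)
  have i: "iso_over Z ({..<n}, d, f \<circ> \<theta>) S"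
    unfolding Z S by (rule iso_overI[OF \<theta>]) (use acts \<theta>S in \<open>auto simp: d_def \<eta>n\<close>)
  show thesis
    by (rule that[OF g i iso_class_eqI[OF gset_over_acts[OF assms(1) g] i]])
qed

lemma coprod_over_acts:
  assumes "group (fst Z)" "acts_over Z S" "acts_over Z T"
  shows "acts_over Z (coprod_over S T)"
  using assms
  by (cases Z; cases S; cases T) (auto simp: group.is_monoid monoid.m_closed)

section \<open>The Grothendieck group and disjoint unions\<close>

abbreviation iso_classes :: "('g, 'z) gset \<Rightarrow> ('g, nat, 'z) over set set" where
  "iso_classes Z \<equiv> {iso_class Z S | S :: ('g, nat, 'z) over. gset_over Z S}"

lemma iso_class_in:
  assumes "group (fst Z)" "acts_over Z S"
  shows "iso_class Z S \<in> iso_classes Z"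
  by (rule iso_class_rep[OF assms]) (metis (mono_tags, lifting) mem_Collect_eq)

abbreviation coprod_gens :: "('g, 'z) gset \<Rightarrow> ('g, 'z) formal_sum set" where
  "coprod_gens Z \<equiv>
     {frag_of (iso_class Z (coprod_over S T)) - frag_of (iso_class Z S) - frag_of (iso_class Z T)
      | (S :: ('g, nat, 'z) over) (T :: ('g, nat, 'z) over). gset_over Z S \<and> gset_over Z T}"

lemma keys_diff_subset:
  "Poly_Mapping.keys x \<subseteq> S \<Longrightarrow> Poly_Mapping.keys y \<subseteq> S \<Longrightarrow>
     Poly_Mapping.keys (x - y :: 'a \<Rightarrow>\<^sub>0 int) \<subseteq> S"
  using keys_diff[of x y] by blast

text \<open>The coproduct of two sets of naturals has elements of a sum type; its class is a free
  generator only by way of a representative on naturals, through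
  \<open>iso_class_in\<close>.\<close>

lemma coprod_gens_keys:
  fixes Z :: "('g, 'z) gset"
  assumes "group (fst Z)"
  shows "coprod_gens Z \<subseteq> {x. Poly_Mapping.keys x \<subseteq> iso_classes Z}"
proof clarify
  fix S T :: "('g, nat, 'z) over" and x
  assume ST: "gset_over Z S" "gset_over Z T"
    and x: "x \<in> Poly_Mapping.keys (frag_of (iso_class Z (coprod_over S T)) - frag_of (iso_class Z S)
       - frag_of (iso_class Z T) :: ('g, 'z) formal_sum)"
  note acts = ST[THEN gset_over_acts[OF assms]]
  have "Poly_Mapping.keys (frag_of (iso_class Z (coprod_over S T)) - frag_of (iso_class Z S)
       - frag_of (iso_class Z T) :: ('g, 'z) formal_sum) \<subseteq> iso_classes Z"
    using iso_class_in[OF assms acts(1)] iso_class_in[OF assms acts(2)]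
      iso_class_in[OF assms coprod_over_acts[OF assms acts]]
    by (intro keys_diff_subset) (auto simp only: keys_frag_of insert_subset empty_subsetI)
  from subsetD[OF this x] show "\<exists>S :: ('g, nat, 'z) over. x = iso_class Z S \<and> gset_over Z S"
    by blast
qed

lemma subgroup_coprod_relations:
  "group (fst Z) \<Longrightarrow> subgroup (coprod_relations Z) (free_Abelian_group (iso_classes Z))"
  unfolding coprod_relations_def free_classes_def
  by (rule subgroup_generate_free[OF coprod_gens_keys])

text \<open>The relations are stated for external coproducts of sets of naturals. An internal
  partition into invariant parts is reduced to one by taking representatives of the parts and gluing
  the two isomorphisms with \<open>case_sum\<close>; disjointness of the parts makes the glued map
  injective.\<close>

lemma coprod_relations_split:
  assumes grp: "group G" and acts: "acts_over (G, Z, c) (S, a, f)"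
    and S: "S = S1 \<union> S2" "S1 \<inter> S2 = {}"
    and inv: "\<And>g s. g \<in> carrier G \<Longrightarrow> s \<in> S1 \<Longrightarrow> a g s \<in> S1"
      "\<And>g s. g \<in> carrier G \<Longrightarrow> s \<in> S2 \<Longrightarrow> a g s \<in> S2"
  shows "frag_of (iso_class (G, Z, c) (S, a, f)) - frag_of (iso_class (G, Z, c) (S1, a, f))
    - frag_of (iso_class (G, Z, c) (S2, a, f)) \<in> coprod_relations (G, Z, c)"
proof -
  have acts12: "acts_over (G, Z, c) (S1, a, f)" "acts_over (G, Z, c) (S2, a, f)"
    using acts inv by (auto simp: S)
  have fst: "group (fst (G, Z, c))" by (simp add: grp)
  obtain T1 :: "(_, nat, _) over" where T1: "gset_over (G, Z, c) T1"
    "iso_over (G, Z, c) T1 (S1, a, f)" "iso_class (G, Z, c) T1 = iso_class (G, Z, c) (S1, a, f)"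
    by (rule iso_class_rep[OF fst acts12(1)])
  obtain T2 :: "(_, nat, _) over" where T2: "gset_over (G, Z, c) T2"
    "iso_over (G, Z, c) T2 (S2, a, f)" "iso_class (G, Z, c) T2 = iso_class (G, Z, c) (S2, a, f)"
    by (rule iso_class_rep[OF fst acts12(2)])
  obtain T1' b1 k1 where eq1: "T1 = (T1', b1, k1)" by (metis prod_cases3)
  obtain T2' b2 k2 where eq2: "T2 = (T2', b2, k2)" by (metis prod_cases3)
  obtain \<theta>1 where \<theta>1: "bij_betw \<theta>1 T1' S1" "\<forall>g\<in>carrier G. \<forall>s\<in>T1'. \<theta>1 (b1 g s) = a g (\<theta>1 s)"
    "\<forall>s\<in>T1'. f (\<theta>1 s) = k1 s" using T1(2) by (auto simp: eq1)
  obtain \<theta>2 where \<theta>2: "bij_betw \<theta>2 T2' S2" "\<forall>g\<in>carrier G. \<forall>s\<in>T2'. \<theta>2 (b2 g s) = a g (\<theta>2 s)"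
    "\<forall>s\<in>T2'. f (\<theta>2 s) = k2 s" using T2(2) by (auto simp: eq2)
  have "bij_betw (case_sum \<theta>1 \<theta>2) (T1' <+> T2') S"
    unfolding bij_betw_def
  proof
    show "inj_on (case_sum \<theta>1 \<theta>2) (T1' <+> T2')"
    proof (rule inj_onI)
      fix x y assume "x \<in> T1' <+> T2'" "y \<in> T1' <+> T2'"
        and eq: "case_sum \<theta>1 \<theta>2 x = case_sum \<theta>1 \<theta>2 y"
      moreover have "\<theta>1 t \<noteq> \<theta>2 u" if "t \<in> T1'" "u \<in> T2'" for t u
        using bij_betwE[OF \<theta>1(1)] bij_betwE[OF \<theta>2(1)] S(2) that by fastforce
      ultimately show "x = y"
        using bij_betw_imp_inj_on[OF \<theta>1(1)] bij_betw_imp_inj_on[OF \<theta>2(1)]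
        by (elim PlusE) (auto dest: inj_onD, metis)
    qed
    show "case_sum \<theta>1 \<theta>2 ` (T1' <+> T2') = S"
      using \<theta>1(1) \<theta>2(1) by (force simp: S(1) bij_betw_def Plus_def image_Un image_image)
  qed
  then have iso: "iso_over (G, Z, c) (coprod_over T1 T2) (S, a, f)"
    unfolding eq1 eq2 coprod_over.simps
    by (rule iso_overI) (use \<theta>1 \<theta>2 in auto)
  note acts = coprod_over_acts[OF fst gset_over_acts[OF fst T1(1)] gset_over_acts[OF fst T2(1)]]
  have "frag_of (iso_class (G, Z, c) (coprod_over T1 T2)) - frag_of (iso_class (G, Z, c) T1)
    - frag_of (iso_class (G, Z, c) T2) \<in> coprod_relations (G, Z, c)"
    unfolding coprod_relations_def using T1(1) T2(1) by (intro generate.incl) blast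
  then show ?thesis
    by (simp add: iso_class_eqI[OF acts iso] T1(3) T2(3))
qed

lemma coprod_relations_sum:
  assumes grp: "group G" and "finite I"
    and "acts_over (G, Z, c) (\<Union>i\<in>I. P i, a, f)" and "\<forall>i\<in>I. \<forall>j\<in>I. i \<noteq> j \<longrightarrow> P i \<inter> P j = {}"
    and "\<And>i g s. i \<in> I \<Longrightarrow> g \<in> carrier G \<Longrightarrow> s \<in> P i \<Longrightarrow> a g s \<in> P i"
  shows "frag_of (iso_class (G, Z, c) (\<Union>i\<in>I. P i, a, f))
    - (\<Sum>i\<in>I. frag_of (iso_class (G, Z, c) (P i, a, f))) \<in> coprod_relations (G, Z, c)"
  using assms(2-)
proof (induction I rule: finite_induct)
  case empty
  have sub: "subgroup (coprod_relations (G, Z, c)) (free_Abelian_group (iso_classes (G, Z, c)))"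
    by (rule subgroup_coprod_relations) (simp add: grp)
  \<comment> \<open>Splitting the empty set into two empty sets puts minus its class among the
    relations, so the class agrees with the empty sum.\<close>
  have "frag_of (iso_class (G, Z, c) ({}, a, f)) - frag_of (iso_class (G, Z, c) ({}, a, f))
    - frag_of (iso_class (G, Z, c) ({}, a, f)) \<in> coprod_relations (G, Z, c)"
    by (rule coprod_relations_split[OF grp]) auto
  then show ?case using subgroup_free_uminus[OF sub] by force
next
  case (insert i I)
  let ?c = "\<lambda>Q. frag_of (iso_class (G, Z, c) (Q, a, f))"
  have sub: "subgroup (coprod_relations (G, Z, c)) (free_Abelian_group (iso_classes (G, Z, c)))"
    by (rule subgroup_coprod_relations) (simp add: grp)
  have "acts_over (G, Z, c) (\<Union>i\<in>I. P i, a, f)"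
    using insert.prems(1,3) by auto
  moreover have "\<forall>i\<in>I. \<forall>j\<in>I. i \<noteq> j \<longrightarrow> P i \<inter> P j = {}"
    using insert.prems(2) by blast
  ultimately have IH: "?c (\<Union>i\<in>I. P i) - (\<Sum>i\<in>I. ?c (P i)) \<in> coprod_relations (G, Z, c)"
    using insert.IH insert.prems(3) by blast
  have "?c (\<Union>i\<in>insert i I. P i) - ?c (P i) - ?c (\<Union>i\<in>I. P i) \<in> coprod_relations (G, Z, c)"
  proof (rule coprod_relations_split[OF grp insert.prems(1)])
    show "P i \<inter> (\<Union>i\<in>I. P i) = {}"
      using insert.prems(2) insert.hyps by fastforce
  qed (use insert.prems(3) in auto)
  from subgroup_free_add[OF sub this IH] show ?case
    using insert.hyps by (simp add: algebra_simps)
qed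

text \<open>Orbit-stabilizer over a base. \<open>T\<close> is tied to the stabilizer by an equation
  so that the star product can be put in its place, and \<open>k\<close> is prescribed only on
  cosets.\<close>

lemma orbit_iso_lcosets:
  fixes G (structure)
  assumes "group G" and acts: "acts_over (G, Z, c) (S, a, f)" and s: "s \<in> S"
    and T: "T = {g \<in> carrier G. a g s = s}"
    and k: "\<And>g. g \<in> carrier G \<Longrightarrow> k (g <#\<^bsub>G\<^esub> T) = f (a g s)"
  shows "iso_over (G, Z, c) ((\<lambda>g. a g s) ` carrier G, a, f) (lcosets\<^bsub>G\<^esub> T, coset_act G T, k)"
proof -
  interpret group G by fact
  have am: "a (g \<otimes> h) s = a g (a h s)" if "g \<in> carrier G" "h \<in> carrier G" for g h
    using acts s that by simp
  have a1: "a (inv g) (a g s) = s" if "g \<in> carrier G" for g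
    using am[of "inv g" g] that acts s by simp
  \<comment> \<open>Sending a point to the set of all elements that carry \<open>s\<close> to it
    avoids choosing one of them; on the orbit these sets are nonempty, hence determine the point,
    and they are left cosets of the stabilizer.\<close>
  define \<theta> where "\<theta> = (\<lambda>x. {g \<in> carrier G. a g s = x})"
  have \<theta>: "\<theta> (a g s) = g <# T" if g: "g \<in> carrier G" for g
  proof
    show "\<theta> (a g s) \<subseteq> g <# T"
    proof
      fix h assume "h \<in> \<theta> (a g s)"
      then have h: "h \<in> carrier G" "a h s = a g s" by (auto simp: \<theta>_def)
      have "inv g \<otimes> h \<in> T"
        using h g am[of "inv g" h] a1[OF g] by (simp add: T)
      moreover have "h = g \<otimes> (inv g \<otimes> h)"
        using g h by (simp add: m_assoc[symmetric])
      ultimately show "h \<in> g <# T" unfolding l_coset_def by blast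
    qed
    show "g <# T \<subseteq> \<theta> (a g s)"
      using g am by (auto simp: l_coset_def \<theta>_def T)
  qed
  have TG: "T \<subseteq> carrier G" by (auto simp: T)
  show ?thesis
  proof (rule iso_overI[where \<theta> = \<theta>])
    show "bij_betw \<theta> ((\<lambda>g. a g s) ` carrier G) (lcosets T)"
      unfolding bij_betw_def
    proof
      show "inj_on \<theta> ((\<lambda>g. a g s) ` carrier G)"
        by (auto simp: inj_on_def \<theta>_def)
      show "\<theta> ` (\<lambda>g. a g s) ` carrier G = lcosets T"
        using \<theta> by (auto simp: LCOSETS_def image_image)
    qed
  next
    fix g x assume g: "g \<in> carrier G" and "x \<in> (\<lambda>g. a g s) ` carrier G"
    then obtain h where h: "h \<in> carrier G" "x = a h s" by auto
    have "h <# T \<in> lcosets T" using h by (auto simp: LCOSETS_def)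
    moreover have "\<theta> (a g x) = (g \<otimes> h) <# T"
      using \<theta>[of "g \<otimes> h"] g h am by simp
    ultimately show "\<theta> (a g x) = coset_act G T g (\<theta> x)"
      using g h TG by (simp add: coset_act_def \<theta> lcos_m_assoc)
  next
    fix x assume "x \<in> (\<lambda>g. a g s) ` carrier G"
    then show "k (\<theta> x) = f x" using \<theta> k by auto
  qed
qed

text \<open>Turns the external coproduct into an internal partition of one set with one action and
  one map, the form in which \<open>comp_split\<close> takes its parts.\<close>

lemma iso_class_coprod_parts:
  assumes "coprod_over (S, a, f) (T, b, k) = (A, d, l)"
    and "acts_over (G, Z, c) (S, a, f)" "acts_over (G, Z, c) (T, b, k)"
  shows "A = Inl ` S \<union> Inr ` T"
    and "acts_over (G, Z, c) (Inl ` S, d, l)" "acts_over (G, Z, c) (Inr ` T, d, l)"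
    and "iso_class (G, Z, c) (Inl ` S, d, l) = iso_class (G, Z, c) (S, a, f)"
    and "iso_class (G, Z, c) (Inr ` T, d, l) = iso_class (G, Z, c) (T, b, k)"
proof -
  have eq: "A = S <+> T" "d = (\<lambda>g. \<lambda>x\<in>S <+> T. map_sum (a g) (b g) x)" "l = case_sum f k"
    using assms(1) by auto
  show "A = Inl ` S \<union> Inr ` T" by (auto simp: eq)
  show "acts_over (G, Z, c) (Inl ` S, d, l)" "acts_over (G, Z, c) (Inr ` T, d, l)"
    using assms(2,3) by (auto simp: eq)
  have "iso_over (G, Z, c) (S, a, f) (Inl ` S, d, l)"
    by (rule iso_overI[where \<theta> = Inl]) (auto simp: eq inj_on_imp_bij_betw)
  then show "iso_class (G, Z, c) (Inl ` S, d, l) = iso_class (G, Z, c) (S, a, f)"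
    by (rule iso_class_eqI[OF assms(2), symmetric])
  have "iso_over (G, Z, c) (T, b, k) (Inr ` T, d, l)"
    by (rule iso_overI[where \<theta> = Inr]) (auto simp: eq inj_on_imp_bij_betw)
  then show "iso_class (G, Z, c) (Inr ` T, d, l) = iso_class (G, Z, c) (T, b, k)"
    by (rule iso_class_eqI[OF assms(3), symmetric])
qed

section \<open>Composition of spans\<close>

definition fibre_pairs ::
  "'v set \<Rightarrow> ('v \<Rightarrow> 'z \<times> 'y) \<Rightarrow> 'u set \<Rightarrow> ('u \<Rightarrow> 'y \<times> 'x) \<Rightarrow> ('v \<times> 'u) set" where
  "fibre_pairs V \<phi> U \<psi> = {(v, u). v \<in> V \<and> u \<in> U \<and> snd (\<phi> v) = fst (\<psi> u)}"

definition pair_act ::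
  "'k monoid \<Rightarrow> 'h monoid \<Rightarrow> 'g monoid \<Rightarrow> ('k \<times> 'h \<Rightarrow> 'v \<Rightarrow> 'v) \<Rightarrow> ('h \<times> 'g \<Rightarrow> 'u \<Rightarrow> 'u) \<Rightarrow>
    'k \<Rightarrow> 'g \<Rightarrow> 'v \<times> 'u \<Rightarrow> 'v \<times> 'u" where
  "pair_act K H G b a k g = map_prod (b (k, \<one>\<^bsub>H\<^esub>)) (a (\<one>\<^bsub>H\<^esub>, g))"

text \<open>Unlike in \<open>span_comp\<close> the action is not restricted to the orbit set, so
  that invariant parts of that set carry literally the same action.\<close>

definition comp_act ::
  "'k monoid \<Rightarrow> 'h monoid \<Rightarrow> 'g monoid \<Rightarrow> ('k \<times> 'h \<Rightarrow> 'v \<Rightarrow> 'v) \<Rightarrow> ('h \<times> 'g \<Rightarrow> 'u \<Rightarrow> 'u) \<Rightarrow>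
    'k \<times> 'g \<Rightarrow> ('v \<times> 'u) set \<Rightarrow> ('v \<times> 'u) set" where
  "comp_act K H G b a kg Q = pair_act K H G b a (fst kg) (snd kg) ` Q"

definition comp_map ::
  "('v \<Rightarrow> 'z \<times> 'y) \<Rightarrow> ('u \<Rightarrow> 'y \<times> 'x) \<Rightarrow> ('v \<times> 'u) set \<Rightarrow> 'z \<times> 'x" where
  "comp_map \<phi> \<psi> Q = the_elem ((\<lambda>(v, u). (fst (\<phi> v), snd (\<psi> u))) ` Q)"

lemma span_comp_eq:
  "span_comp K H G (V, b, \<phi>) (U, a, \<psi>) =
    (let P = biset_orbit K H G b a ` fibre_pairs V \<phi> U \<psi>
     in (P, \<lambda>kg. restrict (comp_act K H G b a kg) P, comp_map \<phi> \<psi>))"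
  by (auto simp: fibre_pairs_def comp_act_def comp_map_def pair_act_def Let_def fun_eq_iff
      map_prod_def split: prod.splits)

text \<open>Inversion permutes \<open>H\<close>, so the orbit for the right action (v h, inv h u) is
  the orbit for the diagonal left action, and the inverses disappear.\<close>

lemma biset_orbit_eq:
  assumes "group H"
  shows "biset_orbit K H G b a p =
    (\<lambda>h. map_prod (b (\<one>\<^bsub>K\<^esub>, h)) (a (h, \<one>\<^bsub>G\<^esub>)) p) ` carrier H"
proof -
  have "(\<lambda>h. inv\<^bsub>H\<^esub> h) ` carrier H = carrier H"
    using group.inv_closed[OF assms] group.inv_inv[OF assms] by (force simp: image_iff)
  then have "(\<lambda>h. map_prod (b (\<one>\<^bsub>K\<^esub>, h)) (a (h, \<one>\<^bsub>G\<^esub>)) p) ` carrier H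
    = (\<lambda>h. map_prod (b (\<one>\<^bsub>K\<^esub>, h)) (a (h, \<one>\<^bsub>G\<^esub>)) p) ` (\<lambda>h. inv\<^bsub>H\<^esub> h) ` carrier H"
    by simp
  then show ?thesis
    by (cases p) (auto simp: biset_orbit_def image_image)
qed

text \<open>The types of \<open>V\<close> and \<open>U\<close> are free and the spans enter through
  \<open>acts_over\<close>: the locale is used for representatives on naturals, for the summands of
  a coproduct and for coset spaces.\<close>

locale composable_spans =
  fixes K :: "'k monoid" and H :: "'h monoid" and G :: "'g monoid"
    and Z :: "'z set" and Y :: "'y set" and X :: "'x set"
    and aZ :: "'k \<Rightarrow> 'z \<Rightarrow> 'z" and aY :: "'h \<Rightarrow> 'y \<Rightarrow> 'y" and aX :: "'g \<Rightarrow> 'x \<Rightarrow> 'x"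
    and V :: "'v set" and b :: "'k \<times> 'h \<Rightarrow> 'v \<Rightarrow> 'v" and \<phi> :: "'v \<Rightarrow> 'z \<times> 'y"
    and U :: "'u set" and a :: "'h \<times> 'g \<Rightarrow> 'u \<Rightarrow> 'u" and \<psi> :: "'u \<Rightarrow> 'y \<times> 'x"
  assumes group_K: "group K" and group_H: "group H" and group_G: "group G"
    and acts_V: "acts_over (prod_gset (K, Z, aZ) (H, Y, aY)) (V, b, \<phi>)"
    and acts_U: "acts_over (prod_gset (H, Y, aY) (G, X, aX)) (U, a, \<psi>)"
begin

sublocale K: group K by (rule group_K)
sublocale H: group H by (rule group_H)
sublocale G: group G by (rule group_G)

abbreviation "pairs \<equiv> fibre_pairs V \<phi> U \<psi>"
abbreviation "orb \<equiv> biset_orbit K H G b a"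
abbreviation "shift h \<equiv> map_prod (b (\<one>\<^bsub>K\<^esub>, h)) (a (h, \<one>\<^bsub>G\<^esub>))"
abbreviation "move \<equiv> pair_act K H G b a"

lemma V_facts:
  assumes "v \<in> V" "k \<in> carrier K" "h \<in> carrier H"
  shows "b (k, h) v \<in> V" "b (\<one>\<^bsub>K\<^esub>, \<one>\<^bsub>H\<^esub>) v = v" "\<phi> v \<in> Z \<times> Y"
    "\<phi> (b (k, h) v) = (aZ k (fst (\<phi> v)), aY h (snd (\<phi> v)))"
    "k' \<in> carrier K \<Longrightarrow> h' \<in> carrier H \<Longrightarrow>
       b (k, h) (b (k', h') v) = b (k \<otimes>\<^bsub>K\<^esub> k', h \<otimes>\<^bsub>H\<^esub> h') v"
proof -
  have "\<phi> \<in> V \<rightarrow> Z \<times> Y" using acts_V by simp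
  then show "\<phi> v \<in> Z \<times> Y" using assms(1) by (rule funcset_mem)
  \<comment> \<open>The product action is a restricted function; it can be evaluated at \<phi> v
    because \<phi> v has just been placed in the product.\<close>
  moreover have "\<phi> (b (k, h) v) =
      (\<lambda>(h, g). \<lambda>(y, x)\<in>Z \<times> Y. (aZ h y, aY g x)) (k, h) (\<phi> v)"
    using acts_V assms unfolding prod_gset.simps acts_over.simps by simp
  ultimately show "\<phi> (b (k, h) v) = (aZ k (fst (\<phi> v)), aY h (snd (\<phi> v)))"
    by (auto simp: split_beta)
qed (use acts_V assms in auto)

lemma U_facts:
  assumes "u \<in> U" "h \<in> carrier H" "g \<in> carrier G"
  shows "a (h, g) u \<in> U" "a (\<one>\<^bsub>H\<^esub>, \<one>\<^bsub>G\<^esub>) u = u" "\<psi> u \<in> Y \<times> X"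
    "\<psi> (a (h, g) u) = (aY h (fst (\<psi> u)), aX g (snd (\<psi> u)))"
    "h' \<in> carrier H \<Longrightarrow> g' \<in> carrier G \<Longrightarrow>
       a (h, g) (a (h', g') u) = a (h \<otimes>\<^bsub>H\<^esub> h', g \<otimes>\<^bsub>G\<^esub> g') u"
proof -
  have "\<psi> \<in> U \<rightarrow> Y \<times> X" using acts_U by simp
  then show "\<psi> u \<in> Y \<times> X" using assms(1) by (rule funcset_mem)
  moreover have "\<psi> (a (h, g) u) =
      (\<lambda>(h, g). \<lambda>(y, x)\<in>Y \<times> X. (aY h y, aX g x)) (h, g) (\<psi> u)"
    using acts_U assms unfolding prod_gset.simps acts_over.simps by simp
  ultimately show "\<psi> (a (h, g) u) = (aY h (fst (\<psi> u)), aX g (snd (\<psi> u)))"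
    by (auto simp: split_beta)
qed (use acts_U assms in auto)

text \<open>The locale knows \<open>aZ\<close>, \<open>aY\<close> and \<open>aX\<close> only through
  the equivariance of the legs, so on the images of the legs the identity law is drawn from that of
  the spans.\<close>

lemma one_fst_\<phi>: "v \<in> V \<Longrightarrow> aZ \<one>\<^bsub>K\<^esub> (fst (\<phi> v)) = fst (\<phi> v)"
  using V_facts(2,4)[of v "\<one>\<^bsub>K\<^esub>" "\<one>\<^bsub>H\<^esub>"] by (metis H.one_closed K.one_closed fst_conv)

lemma one_snd_\<phi>: "v \<in> V \<Longrightarrow> aY \<one>\<^bsub>H\<^esub> (snd (\<phi> v)) = snd (\<phi> v)"
  using V_facts(2,4)[of v "\<one>\<^bsub>K\<^esub>" "\<one>\<^bsub>H\<^esub>"] by (metis H.one_closed K.one_closed snd_conv)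

lemma one_fst_\<psi>: "u \<in> U \<Longrightarrow> aY \<one>\<^bsub>H\<^esub> (fst (\<psi> u)) = fst (\<psi> u)"
  using U_facts(2,4)[of u "\<one>\<^bsub>H\<^esub>" "\<one>\<^bsub>G\<^esub>"] by (metis H.one_closed G.one_closed fst_conv)

lemma one_snd_\<psi>: "u \<in> U \<Longrightarrow> aX \<one>\<^bsub>G\<^esub> (snd (\<psi> u)) = snd (\<psi> u)"
  using U_facts(2,4)[of u "\<one>\<^bsub>H\<^esub>" "\<one>\<^bsub>G\<^esub>"] by (metis H.one_closed G.one_closed snd_conv)

lemma pairs_subset: "pairs \<subseteq> V \<times> U"
  by (auto simp: fibre_pairs_def)

lemma finite_pairs: "finite pairs"
  by (rule finite_subset[OF pairs_subset]) (use acts_V acts_U in auto)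

lemma shift_pairs: "p \<in> pairs \<Longrightarrow> h \<in> carrier H \<Longrightarrow> shift h p \<in> pairs"
  by (auto simp: fibre_pairs_def V_facts U_facts)

lemma move_pairs: "p \<in> pairs \<Longrightarrow> k \<in> carrier K \<Longrightarrow> g \<in> carrier G \<Longrightarrow> move k g p \<in> pairs"
  by (auto simp: fibre_pairs_def V_facts U_facts one_snd_\<phi> one_fst_\<psi> pair_act_def)

lemma shift_shift:
  "p \<in> pairs \<Longrightarrow> h \<in> carrier H \<Longrightarrow> h' \<in> carrier H \<Longrightarrow> shift h (shift h' p) = shift (h \<otimes>\<^bsub>H\<^esub> h') p"
  by (auto simp: fibre_pairs_def V_facts U_facts)

lemma shift_one: "p \<in> pairs \<Longrightarrow> shift \<one>\<^bsub>H\<^esub> p = p"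
  using V_facts(2)[OF _ K.one_closed H.one_closed] U_facts(2)[OF _ H.one_closed G.one_closed]
  by (auto simp: fibre_pairs_def)

text \<open>On each factor the two maps come from different components of a direct product and so
  commute; hence \<open>K \<times> G\<close> acts on the \<open>H\<close>-orbits.\<close>

lemma move_shift:
  "p \<in> pairs \<Longrightarrow> h \<in> carrier H \<Longrightarrow> k \<in> carrier K \<Longrightarrow> g \<in> carrier G \<Longrightarrow>
     move k g (shift h p) = shift h (move k g p)"
  by (auto simp: fibre_pairs_def V_facts U_facts pair_act_def)

lemma move_move:
  "p \<in> pairs \<Longrightarrow> k \<in> carrier K \<Longrightarrow> g \<in> carrier G \<Longrightarrow> k' \<in> carrier K \<Longrightarrow> g' \<in> carrier G \<Longrightarrow>
     move k g (move k' g' p) = move (k \<otimes>\<^bsub>K\<^esub> k') (g \<otimes>\<^bsub>G\<^esub> g') p"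
  by (auto simp: fibre_pairs_def V_facts U_facts pair_act_def)

lemma move_one: "p \<in> pairs \<Longrightarrow> move \<one>\<^bsub>K\<^esub> \<one>\<^bsub>G\<^esub> p = p"
  using V_facts(2)[OF _ K.one_closed H.one_closed] U_facts(2)[OF _ H.one_closed G.one_closed]
  by (auto simp: fibre_pairs_def pair_act_def)

lemma orb_eq: "orb p = (\<lambda>h. shift h p) ` carrier H"
  by (rule biset_orbit_eq[OF group_H])

lemma orb_self: "p \<in> pairs \<Longrightarrow> p \<in> orb p"
  unfolding orb_eq by (rule image_eqI[where x = "\<one>\<^bsub>H\<^esub>"]) (rule shift_one[symmetric], simp_all)

lemma orb_subset: "p \<in> pairs \<Longrightarrow> orb p \<subseteq> pairs"
  by (auto simp only: orb_eq intro: shift_pairs)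

text \<open>Right translation by \<open>h\<close> permutes \<open>H\<close> and only reindexes the
  orbit.\<close>

lemma orb_shift:
  assumes p: "p \<in> pairs" and h: "h \<in> carrier H"
  shows "orb (shift h p) = orb p"
proof -
  have "(\<lambda>x. x \<otimes>\<^bsub>H\<^esub> h) ` carrier H = carrier H"
  proof
    show "carrier H \<subseteq> (\<lambda>x. x \<otimes>\<^bsub>H\<^esub> h) ` carrier H"
    proof
      fix x assume "x \<in> carrier H"
      then have "x = (x \<otimes>\<^bsub>H\<^esub> inv\<^bsub>H\<^esub> h) \<otimes>\<^bsub>H\<^esub> h" "x \<otimes>\<^bsub>H\<^esub> inv\<^bsub>H\<^esub> h \<in> carrier H"
        using h by (simp_all add: H.m_assoc)
      then show "x \<in> (\<lambda>x. x \<otimes>\<^bsub>H\<^esub> h) ` carrier H" by blast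
    qed
  qed (use h in auto)
  moreover have "orb (shift h p) = (\<lambda>x. shift x p) ` (\<lambda>x. x \<otimes>\<^bsub>H\<^esub> h) ` carrier H"
    by (simp add: orb_eq image_image shift_shift p h cong: image_cong_simp)
  ultimately show ?thesis by (simp only: orb_eq)
qed

lemma orb_eq_iff:
  assumes "p \<in> pairs" "q \<in> pairs"
  shows "orb p = orb q \<longleftrightarrow> (\<exists>h\<in>carrier H. q = shift h p)"
proof
  assume "orb p = orb q"
  then have "q \<in> orb p" using orb_self[OF assms(2)] by simp
  then show "\<exists>h\<in>carrier H. q = shift h p" by (simp only: orb_eq) blast
qed (use orb_shift[OF assms(1)] in auto)

lemma comp_act_orb:
  assumes "p \<in> pairs" "k \<in> carrier K" "g \<in> carrier G"
  shows "comp_act K H G b a (k, g) (orb p) = orb (move k g p)"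
  by (simp add: comp_act_def orb_eq image_image move_shift assms cong: image_cong_simp)

text \<open>A shift acts on \<open>Z\<close> and on \<open>X\<close> through identity elements, so
  the outer legs are constant on an orbit and \<open>the_elem\<close> is applied to a
  singleton.\<close>

lemma comp_map_orb:
  assumes "p \<in> pairs"
  shows "comp_map \<phi> \<psi> (orb p) = (fst (\<phi> (fst p)), snd (\<psi> (snd p)))"
proof -
  have "(\<lambda>(v, u). (fst (\<phi> v), snd (\<psi> u))) ` orb p = (\<lambda>_. (fst (\<phi> (fst p)), snd (\<psi> (snd p)))) ` carrier H"
    unfolding orb_eq image_image
    by (rule image_cong[OF refl])
      (use assms in \<open>auto simp: fibre_pairs_def V_facts U_facts one_fst_\<phi> one_snd_\<psi>\<close>)
  moreover have "carrier H \<noteq> {}" using H.one_closed by blast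
  ultimately show ?thesis by (simp add: comp_map_def image_constant_conv)
qed

lemma acts_over_comp:
  "acts_over (prod_gset (K, Z, aZ) (G, X, aX)) (orb ` pairs, comp_act K H G b a, comp_map \<phi> \<psi>)"
  unfolding prod_gset.simps acts_over.simps
proof (intro conjI ballI)
  show "finite (orb ` pairs)" using finite_pairs by simp
  show "comp_map \<phi> \<psi> \<in> orb ` pairs \<rightarrow> Z \<times> X"
  proof (intro funcsetI, elim imageE)
    fix Q p assume "Q = orb p" "p \<in> pairs"
    then show "comp_map \<phi> \<psi> Q \<in> Z \<times> X"
      using V_facts(3)[OF _ K.one_closed H.one_closed, of "fst p"]
        U_facts(3)[OF _ H.one_closed G.one_closed, of "snd p"]
      by (auto simp: comp_map_orb fibre_pairs_def mem_Times_iff)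
  qed
next
  fix kg Q assume "kg \<in> carrier (K \<times>\<times> G)" "Q \<in> orb ` pairs"
  then obtain k g p where [simp]: "kg = (k, g)" "k \<in> carrier K" "g \<in> carrier G" "Q = orb p" "p \<in> pairs"
    by auto
  show "comp_act K H G b a kg Q \<in> orb ` pairs"
    by (simp add: comp_act_orb move_pairs)
  obtain v u where p: "p = (v, u)" "v \<in> V" "u \<in> U" using \<open>p \<in> pairs\<close> by (auto simp: fibre_pairs_def)
  have "fst (\<phi> v) \<in> Z" "snd (\<psi> u) \<in> X"
    using V_facts(3)[OF p(2) K.one_closed H.one_closed] U_facts(3)[OF p(3) H.one_closed G.one_closed]
    by auto
  then show "comp_map \<phi> \<psi> (comp_act K H G b a kg Q) =
      (\<lambda>(h, g). \<lambda>(y, x)\<in>Z \<times> X. (aZ h y, aX g x)) kg (comp_map \<phi> \<psi> Q)"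
    by (simp add: comp_act_orb comp_map_orb move_pairs)
      (simp add: p pair_act_def V_facts U_facts)
next
  fix Q assume "Q \<in> orb ` pairs"
  then show "comp_act K H G b a \<one>\<^bsub>K \<times>\<times> G\<^esub> Q = Q"
    by (auto simp: comp_act_orb move_one)
next
  fix kg kg' Q assume "kg \<in> carrier (K \<times>\<times> G)" "kg' \<in> carrier (K \<times>\<times> G)" "Q \<in> orb ` pairs"
  then show "comp_act K H G b a (kg \<otimes>\<^bsub>K \<times>\<times> G\<^esub> kg') Q
      = comp_act K H G b a kg (comp_act K H G b a kg' Q)"
    by (auto simp: comp_act_orb move_move move_pairs)
qed

lemma iso_class_span_comp:
  "iso_class (prod_gset (K, Z, aZ) (G, X, aX)) (span_comp K H G (V, b, \<phi>) (U, a, \<psi>)) =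
   iso_class (prod_gset (K, Z, aZ) (G, X, aX)) (orb ` pairs, comp_act K H G b a, comp_map \<phi> \<psi>)"
  unfolding span_comp_eq prod_gset.simps Let_def by (rule iso_class_cong) simp_all

text \<open>The product of the two isomorphisms maps orbits onto orbits. It is injective on
  \<open>V \<times> U\<close>, which contains every orbit, and so taking images is injective on the
  set of orbits.\<close>

lemma iso_span_comp:
  assumes V': "iso_over (prod_gset (K, Z, aZ) (H, Y, aY)) (V, b, \<phi>) (V', b', \<phi>')"
    and U': "iso_over (prod_gset (H, Y, aY) (G, X, aX)) (U, a, \<psi>) (U', a', \<psi>')"
  shows "iso_over (prod_gset (K, Z, aZ) (G, X, aX))
    (orb ` pairs, comp_act K H G b a, comp_map \<phi> \<psi>)
    (biset_orbit K H G b' a' ` fibre_pairs V' \<phi>' U' \<psi>', comp_act K H G b' a', comp_map \<phi>' \<psi>')"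
proof -
  obtain \<theta> where \<theta>: "bij_betw \<theta> V V'"
    "\<And>k h v. k \<in> carrier K \<Longrightarrow> h \<in> carrier H \<Longrightarrow> v \<in> V \<Longrightarrow> \<theta> (b (k, h) v) = b' (k, h) (\<theta> v)"
    "\<And>v. v \<in> V \<Longrightarrow> \<phi>' (\<theta> v) = \<phi> v" using V' by auto
  obtain \<eta> where \<eta>: "bij_betw \<eta> U U'"
    "\<And>h g u. h \<in> carrier H \<Longrightarrow> g \<in> carrier G \<Longrightarrow> u \<in> U \<Longrightarrow> \<eta> (a (h, g) u) = a' (h, g) (\<eta> u)"
    "\<And>u. u \<in> U \<Longrightarrow> \<psi>' (\<eta> u) = \<psi> u" using U' by auto
  let ?m = "map_prod \<theta> \<eta>"
  have pairs': "fibre_pairs V' \<phi>' U' \<psi>' = ?m ` pairs"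
    using \<theta>(1,3) \<eta>(1,3) by (force simp: fibre_pairs_def bij_betw_def)
  have orb': "biset_orbit K H G b' a' (?m p) = ?m ` orb p" if "p \<in> pairs" for p
    unfolding biset_orbit_eq[OF group_H] image_image
    by (rule image_cong[OF refl]) (use that in \<open>auto simp: fibre_pairs_def \<theta> \<eta>\<close>)
  have sub: "Q \<subseteq> V \<times> U" if "Q \<in> orb ` pairs" for Q
    using that orb_subset pairs_subset by fast
  have inj: "inj_on ?m (V \<times> U)"
    by (rule map_prod_inj_on) (use \<theta>(1) \<eta>(1) in \<open>auto simp: bij_betw_def\<close>)
  show ?thesis
    unfolding prod_gset.simps
  proof (rule iso_overI[where \<theta> = "image ?m"])
    have "inj_on (image ?m) (orb ` pairs)"
      using inj_on_image_eq_iff[OF inj] sub by (auto intro!: inj_onI)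
    moreover have "image ?m ` orb ` pairs = biset_orbit K H G b' a' ` fibre_pairs V' \<phi>' U' \<psi>'"
      unfolding pairs' image_image by (rule image_cong[OF refl]) (simp add: orb')
    ultimately show "bij_betw (image ?m) (orb ` pairs)
        (biset_orbit K H G b' a' ` fibre_pairs V' \<phi>' U' \<psi>')"
      by (simp add: bij_betw_def)
  next
    fix kg Q assume kg: "kg \<in> carrier (K \<times>\<times> G)" and Q: "Q \<in> orb ` pairs"
    show "?m ` comp_act K H G b a kg Q = comp_act K H G b' a' kg (?m ` Q)"
      unfolding comp_act_def image_image
      by (rule image_cong[OF refl]) (use kg sub[OF Q] in \<open>auto simp: pair_act_def \<theta> \<eta>\<close>)
  next
    fix Q assume Q: "Q \<in> orb ` pairs"
    have "(\<lambda>(v, u). (fst (\<phi>' v), snd (\<psi>' u))) ` ?m ` Q = (\<lambda>(v, u). (fst (\<phi> v), snd (\<psi> u))) ` Q"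
      unfolding image_image
      by (rule image_cong[OF refl]) (use sub[OF Q] in \<open>auto simp: \<theta> \<eta>\<close>)
    then show "comp_map \<phi>' \<psi>' (?m ` Q) = comp_map \<phi> \<psi> Q" by (simp add: comp_map_def)
  qed
qed

text \<open>Any two representatives give isomorphic composites by \<open>iso_span_comp\<close>, so
  all the united classes equal the class of the composite of the given spans, whatever the types of
  these are.\<close>

lemma iso_class_comp_eq:
  "iso_class_comp (G, X, aX) (H, Y, aY) (K, Z, aZ)
     (iso_class (prod_gset (K, Z, aZ) (H, Y, aY)) (V, b, \<phi>))
     (iso_class (prod_gset (H, Y, aY) (G, X, aX)) (U, a, \<psi>)) =
   iso_class (prod_gset (K, Z, aZ) (G, X, aX)) (orb ` pairs, comp_act K H G b a, comp_map \<phi> \<psi>)"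
proof -
  let ?ZY = "prod_gset (K, Z, aZ) (H, Y, aY)" and ?YX = "prod_gset (H, Y, aY) (G, X, aX)"
    and ?ZX = "prod_gset (K, Z, aZ) (G, X, aX)"
  have grp: "group (fst ?ZY)" "group (fst ?YX)"
    by (simp_all add: DirProd_group group_K group_H group_G)
  have eq: "iso_class ?ZX (span_comp K H G V' U') =
     iso_class ?ZX (orb ` pairs, comp_act K H G b a, comp_map \<phi> \<psi>)"
    if V': "V' \<in> iso_class ?ZY (V, b, \<phi>)" and U': "U' \<in> iso_class ?YX (U, a, \<psi>)" for V' U'
  proof -
    obtain W d \<omega> where V'_eq: "V' = (W, d, \<omega>)" by (metis prod_cases3)
    obtain W' d' \<omega>' where U'_eq: "U' = (W', d', \<omega>')" by (metis prod_cases3)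
    have W: "gset_over ?ZY (W, d, \<omega>)" "iso_over ?ZY (W, d, \<omega>) (V, b, \<phi>)"
      and W': "gset_over ?YX (W', d', \<omega>')" "iso_over ?YX (W', d', \<omega>') (U, a, \<psi>)"
      using V' U' unfolding V'_eq U'_eq iso_class_def by (blast, blast, blast, blast)
    interpret C: composable_spans K H G Z Y X aZ aY aX W d \<omega> W' d' \<omega>'
      using gset_over_acts[OF grp(1) W(1)] gset_over_acts[OF grp(2) W'(1)]
      by (intro composable_spans.intro group_K group_H group_G)
    show ?thesis
      unfolding V'_eq U'_eq C.iso_class_span_comp
      by (rule iso_class_eqI[OF C.acts_over_comp C.iso_span_comp[OF W(2) W'(2)]])
  qed
  \<comment> \<open>Representatives on naturals exist, so the union is not over an empty
    family.\<close>
  obtain V' where V': "V' \<in> iso_class ?ZY (V, b, \<phi>)"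
    by (rule iso_class_rep[OF grp(1) acts_V]) (unfold iso_class_def, blast)
  obtain U' where U': "U' \<in> iso_class ?YX (U, a, \<psi>)"
    by (rule iso_class_rep[OF grp(2) acts_U]) (unfold iso_class_def, blast)
  show ?thesis
    unfolding iso_class_comp_def fst_conv
  proof (intro subset_antisym UN_least)
    show "iso_class ?ZX (orb ` pairs, comp_act K H G b a, comp_map \<phi> \<psi>)
      \<subseteq> (\<Union>V'\<in>iso_class ?ZY (V, b, \<phi>). \<Union>U'\<in>iso_class ?YX (U, a, \<psi>).
           iso_class ?ZX (span_comp K H G V' U'))"
      unfolding eq[OF V' U', symmetric] using V' U' by blast
  qed (rule equalityD1[OF eq])
qed

text \<open>Splitting off a part of either factor is an instance of this.\<close>

lemma comp_split:
  assumes "composable_spans K H G Z Y X aZ aY aX V1 b \<phi> U1 a \<psi>"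
    and "composable_spans K H G Z Y X aZ aY aX V2 b \<phi> U2 a \<psi>"
    and "V \<times> U = V1 \<times> U1 \<union> V2 \<times> U2" "V1 \<times> U1 \<inter> V2 \<times> U2 = {}"
  defines "cls \<equiv> \<lambda>V' U'. frag_of (iso_class_comp (G, X, aX) (H, Y, aY) (K, Z, aZ)
     (iso_class (prod_gset (K, Z, aZ) (H, Y, aY)) (V', b, \<phi>))
     (iso_class (prod_gset (H, Y, aY) (G, X, aX)) (U', a, \<psi>)))"
  shows "cls V U - cls V1 U1 - cls V2 U2 \<in> coprod_relations (prod_gset (K, Z, aZ) (G, X, aX))"
proof -
  interpret C1: composable_spans K H G Z Y X aZ aY aX V1 b \<phi> U1 a \<psi> by fact
  interpret C2: composable_spans K H G Z Y X aZ aY aX V2 b \<phi> U2 a \<psi> by fact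
  have un: "pairs = C1.pairs \<union> C2.pairs"
  proof -
    have "pairs = {p \<in> V \<times> U. snd (\<phi> (fst p)) = fst (\<psi> (snd p))}"
      "C1.pairs = {p \<in> V1 \<times> U1. snd (\<phi> (fst p)) = fst (\<psi> (snd p))}"
      "C2.pairs = {p \<in> V2 \<times> U2. snd (\<phi> (fst p)) = fst (\<psi> (snd p))}"
      by (auto simp: fibre_pairs_def)
    then show ?thesis using assms(3) by blast
  qed
  \<comment> \<open>Each part is closed under the shifts by \<open>H\<close>, so an orbit stays
    within one of the two disjoint rectangles.\<close>
  have disj: "orb ` C1.pairs \<inter> orb ` C2.pairs = {}"
  proof (rule equals0I)
    fix Q assume "Q \<in> orb ` C1.pairs \<inter> orb ` C2.pairs"
    then obtain p q where "p \<in> C1.pairs" "Q = orb p" "q \<in> C2.pairs" "Q = orb q" by blast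
    then have "p \<in> V1 \<times> U1 \<inter> V2 \<times> U2"
      using C1.orb_self C2.orb_subset C2.pairs_subset C1.pairs_subset by blast
    then show False using assms(4) by simp
  qed
  show ?thesis
    unfolding cls_def iso_class_comp_eq C1.iso_class_comp_eq C2.iso_class_comp_eq
    unfolding prod_gset.simps
  proof (rule coprod_relations_split)
    show "group (K \<times>\<times> G)" by (simp add: DirProd_group group_K group_G)
    show "acts_over (K \<times>\<times> G, Z \<times> X, \<lambda>(h, g). \<lambda>(y, x)\<in>Z \<times> X. (aZ h y, aX g x))
      (orb ` pairs, comp_act K H G b a, comp_map \<phi> \<psi>)"
      using acts_over_comp by (simp only: prod_gset.simps)
    show "orb ` pairs = orb ` C1.pairs \<union> orb ` C2.pairs" by (simp add: un image_Un)
    show "orb ` C1.pairs \<inter> orb ` C2.pairs = {}" by (rule disj)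
  next
    fix kg Q assume "kg \<in> carrier (K \<times>\<times> G)" "Q \<in> orb ` C1.pairs"
    then show "comp_act K H G b a kg Q \<in> orb ` C1.pairs"
      using C1.acts_over_comp unfolding prod_gset.simps acts_over.simps by blast
  next
    fix kg Q assume "kg \<in> carrier (K \<times>\<times> G)" "Q \<in> orb ` C2.pairs"
    then show "comp_act K H G b a kg Q \<in> orb ` C2.pairs"
      using C2.acts_over_comp unfolding prod_gset.simps acts_over.simps by blast
  qed
qed

end

section \<open>Composition on the Grothendieck groups\<close>

abbreviation iso_comp ::
  "('g, 'x) gset \<Rightarrow> ('h, 'y) gset \<Rightarrow> ('k, 'z) gset \<Rightarrow>
   ('k \<times> 'h, nat, 'z \<times> 'y) over set \<Rightarrow> ('h \<times> 'g, nat, 'y \<times> 'x) over set \<Rightarrow>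
   ('k \<times> 'g, 'z \<times> 'x) formal_sum" where
  "iso_comp \<X> \<Y> \<Z> \<equiv> \<lambda>I J. frag_of (iso_class_comp \<X> \<Y> \<Z> I J)"

text \<open>Statements about formal sums range over many spans at once, so only the groups and the
  base sets are fixed here.\<close>

locale three_groups =
  fixes K :: "'k monoid" and H :: "'h monoid" and G :: "'g monoid"
    and Z :: "'z set" and Y :: "'y set" and X :: "'x set"
    and aZ :: "'k \<Rightarrow> 'z \<Rightarrow> 'z" and aY :: "'h \<Rightarrow> 'y \<Rightarrow> 'y" and aX :: "'g \<Rightarrow> 'x \<Rightarrow> 'x"
  assumes group_K: "group K" and group_H: "group H" and group_G: "group G"
begin

abbreviation "ZY \<equiv> prod_gset (K, Z, aZ) (H, Y, aY)"
abbreviation "YX \<equiv> prod_gset (H, Y, aY) (G, X, aX)"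
abbreviation "ZX \<equiv> prod_gset (K, Z, aZ) (G, X, aX)"
abbreviation "icomp \<equiv> iso_comp (G, X, aX) (H, Y, aY) (K, Z, aZ)"

lemma grp: "group (fst ZY)" "group (fst YX)" "group (fst ZX)"
  by (simp_all add: DirProd_group group_K group_H group_G)

lemma composableI:
  "acts_over ZY (V, b, \<phi>) \<Longrightarrow> acts_over YX (U, a, \<psi>) \<Longrightarrow>
     composable_spans K H G Z Y X aZ aY aX V b \<phi> U a \<psi>"
  by (rule composable_spans.intro[OF group_K group_H group_G])

text \<open>The coproduct is cut into its two injected copies, and the second factor is kept whole
  in both rectangles of \<open>comp_split\<close>.\<close>

lemma icomp_left:
  assumes "gset_over ZY S" "gset_over ZY T" "gset_over YX J"
  shows "icomp (iso_class ZY (coprod_over S T)) (iso_class YX J)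
      - icomp (iso_class ZY S) (iso_class YX J) - icomp (iso_class ZY T) (iso_class YX J)
    \<in> coprod_relations ZX"
proof -
  obtain S' a f where S: "S = (S', a, f)" by (metis prod_cases3)
  obtain T' b k where T: "T = (T', b, k)" by (metis prod_cases3)
  obtain U d \<psi> where J: "J = (U, d, \<psi>)" by (metis prod_cases3)
  obtain A e l where A: "coprod_over (S', a, f) (T', b, k) = (A, e, l)" by (metis prod_cases3)
  note acts = gset_over_acts[OF grp(1) assms(1)] gset_over_acts[OF grp(1) assms(2)]
    gset_over_acts[OF grp(2) assms(3)]
  note parts = iso_class_coprod_parts[OF A, where G = "K \<times>\<times> H" and Z = "Z \<times> Y",
      OF acts(1,2)[unfolded S T prod_gset.simps], folded prod_gset.simps]
  have all: "acts_over ZY (A, e, l)"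
    using coprod_over_acts[OF grp(1) acts(1,2)] by (simp only: S T A)
  interpret composable_spans K H G Z Y X aZ aY aX A e l U d \<psi>
    by (rule composableI[OF all]) (use acts in \<open>simp only: J\<close>)
  have "composable_spans K H G Z Y X aZ aY aX (Inl ` S') e l U d \<psi>"
    "composable_spans K H G Z Y X aZ aY aX (Inr ` T') e l U d \<psi>"
    by (rule composableI; use parts acts J in simp)+
  then have "icomp (iso_class ZY (A, e, l)) (iso_class YX J)
      - icomp (iso_class ZY (Inl ` S', e, l)) (iso_class YX J)
      - icomp (iso_class ZY (Inr ` T', e, l)) (iso_class YX J) \<in> coprod_relations ZX"
    unfolding J by (rule comp_split) (auto simp: parts(1))
  then show ?thesis
    by (simp only: S T A parts)
qed

lemma icomp_right:
  assumes "gset_over ZY J" "gset_over YX S" "gset_over YX T"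
  shows "icomp (iso_class ZY J) (iso_class YX (coprod_over S T))
      - icomp (iso_class ZY J) (iso_class YX S) - icomp (iso_class ZY J) (iso_class YX T)
    \<in> coprod_relations ZX"
proof -
  obtain S' a f where S: "S = (S', a, f)" by (metis prod_cases3)
  obtain T' b k where T: "T = (T', b, k)" by (metis prod_cases3)
  obtain V d \<phi> where J: "J = (V, d, \<phi>)" by (metis prod_cases3)
  obtain A e l where A: "coprod_over (S', a, f) (T', b, k) = (A, e, l)" by (metis prod_cases3)
  note acts = gset_over_acts[OF grp(2) assms(2)] gset_over_acts[OF grp(2) assms(3)]
    gset_over_acts[OF grp(1) assms(1)]
  note parts = iso_class_coprod_parts[OF A, where G = "H \<times>\<times> G" and Z = "Y \<times> X",
      OF acts(1,2)[unfolded S T prod_gset.simps], folded prod_gset.simps]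
  have all: "acts_over YX (A, e, l)"
    using coprod_over_acts[OF grp(2) acts(1,2)] by (simp only: S T A)
  interpret composable_spans K H G Z Y X aZ aY aX V d \<phi> A e l
    by (rule composableI[OF _ all]) (use acts in \<open>simp only: J\<close>)
  have "composable_spans K H G Z Y X aZ aY aX V d \<phi> (Inl ` S') e l"
    "composable_spans K H G Z Y X aZ aY aX V d \<phi> (Inr ` T') e l"
    by (rule composableI; use parts acts J in simp)+
  then have "icomp (iso_class ZY J) (iso_class YX (A, e, l))
      - icomp (iso_class ZY J) (iso_class YX (Inl ` S', e, l))
      - icomp (iso_class ZY J) (iso_class YX (Inr ` T', e, l)) \<in> coprod_relations ZX"
    unfolding J by (rule comp_split) (auto simp: parts(1))
  then show ?thesis
    by (simp only: S T A parts)
qed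

lemma icomp_keys:
  assumes "I \<in> iso_classes ZY" "J \<in> iso_classes YX"
  shows "Poly_Mapping.keys (icomp I J) \<subseteq> iso_classes ZX"
proof -
  obtain V :: "nat set" and b \<phi> and U :: "nat set" and a \<psi> where V: "I = iso_class ZY (V, b, \<phi>)" "gset_over ZY (V, b, \<phi>)"
    and U: "J = iso_class YX (U, a, \<psi>)" "gset_over YX (U, a, \<psi>)"
  proof -
    from assms obtain V' :: "('k \<times> 'h, nat, 'z \<times> 'y) over"
      and U' :: "('h \<times> 'g, nat, 'y \<times> 'x) over" where V': "I = iso_class ZY V'" "gset_over ZY V'"
      and U': "J = iso_class YX U'" "gset_over YX U'" by blast
    obtain V b \<phi> where "V' = (V, b, \<phi>)" by (metis prod_cases3)
    moreover obtain U a \<psi> where "U' = (U, a, \<psi>)" by (metis prod_cases3)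
    ultimately show thesis using V' U' by (intro that) (simp_all only:)
  qed
  interpret composable_spans K H G Z Y X aZ aY aX V b \<phi> U a \<psi>
    by (rule composableI[OF gset_over_acts[OF grp(1) V(2)] gset_over_acts[OF grp(2) U(2)]])
  show ?thesis
    using iso_class_in[OF grp(3) acts_over_comp]
    by (simp only: V(1) U(1) iso_class_comp_eq keys_frag_of insert_subset empty_subsetI simp_thms)
qed

text \<open>Descent of the biadditive extension of \<open>icomp\<close>: the generating coproduct
  relations in either factor go to relations by \<open>icomp_left\<close> and
  \<open>icomp_right\<close>.\<close>

lemma burnside_comp_cosets:
  assumes c: "Poly_Mapping.keys c \<subseteq> iso_classes ZY" and d: "Poly_Mapping.keys d \<subseteq> iso_classes YX"
  shows "burnside_comp (G, X, aX) (H, Y, aY) (K, Z, aZ)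
      (coprod_relations ZY #>\<^bsub>free_classes ZY\<^esub> c) (coprod_relations YX #>\<^bsub>free_classes YX\<^esub> d)
    = coprod_relations ZX #>\<^bsub>free_classes ZX\<^esub> frag_extend2 icomp c d"
proof -
  have left: "frag_extend2 icomp r (frag_of J) \<in> coprod_relations ZX"
    if "r \<in> coprod_gens ZY" "J \<in> iso_classes YX" for r J
  proof -
    obtain S T :: "('k \<times> 'h, nat, 'z \<times> 'y) over" where
      r: "r = frag_of (iso_class ZY (coprod_over S T)) - frag_of (iso_class ZY S)
        - frag_of (iso_class ZY T)" and ST: "gset_over ZY S" "gset_over ZY T"
      using \<open>r \<in> coprod_gens ZY\<close> by blast
    obtain U :: "('h \<times> 'g, nat, 'y \<times> 'x) over" where
      J: "J = iso_class YX U" "gset_over YX U" using \<open>J \<in> iso_classes YX\<close> by blast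
    show ?thesis
      unfolding r J(1) frag_extend2_diff frag_extend2_of by (rule icomp_left[OF ST J(2)])
  qed
  have right: "frag_extend2 icomp (frag_of J) r \<in> coprod_relations ZX"
    if "J \<in> iso_classes ZY" "r \<in> coprod_gens YX" for r J
  proof -
    obtain S T :: "('h \<times> 'g, nat, 'y \<times> 'x) over" where
      r: "r = frag_of (iso_class YX (coprod_over S T)) - frag_of (iso_class YX S)
        - frag_of (iso_class YX T)" and ST: "gset_over YX S" "gset_over YX T"
      using \<open>r \<in> coprod_gens YX\<close> by blast
    obtain V :: "('k \<times> 'h, nat, 'z \<times> 'y) over" where
      J: "J = iso_class ZY V" "gset_over ZY V" using \<open>J \<in> iso_classes ZY\<close> by blast
    show ?thesis
      unfolding r J(1) frag_extend2_diff frag_extend2_of by (rule icomp_right[OF J(2) ST])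
  qed
  show ?thesis
    unfolding burnside_comp_def free_classes_def frag_extend2_def[symmetric]
    by (rule frag_extend2_cosets[OF coprod_relations_def[unfolded free_classes_def]
          coprod_gens_keys[OF grp(1)] coprod_relations_def[unfolded free_classes_def]
          coprod_gens_keys[OF grp(2)] subgroup_coprod_relations[OF grp(3)] left right c d])
qed

end

section \<open>Extension of scalars\<close>

lemma carrier_burnside:
  "carrier (burnside Z) =
    {coprod_relations Z #>\<^bsub>free_classes Z\<^esub> c | c. Poly_Mapping.keys c \<subseteq> iso_classes Z}"
  unfolding burnside_def free_classes_def by (rule carrier_Mod_free)

lemma burnside_mult:
  assumes "group (fst Z)"
  shows "(coprod_relations Z #>\<^bsub>free_classes Z\<^esub> c) \<otimes>\<^bsub>burnside Z\<^esub> (coprod_relations Z #>\<^bsub>free_classes Z\<^esub> d)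
    = coprod_relations Z #>\<^bsub>free_classes Z\<^esub> (c + d)"
  unfolding burnside_def mult_FactGroup free_classes_def
  by (rule rcos_free_mult[OF subgroup_coprod_relations[OF assms]])

lemma comm_group_burnside: "group (fst Z) \<Longrightarrow> comm_group (burnside Z)"
  unfolding burnside_def free_classes_def
  by (rule comm_group_Mod_free[OF subgroup_coprod_relations])

abbreviation tensor_gens :: "'r ring \<Rightarrow> 'b monoid \<Rightarrow> ('r \<times> 'b \<Rightarrow>\<^sub>0 int) set" where
  "tensor_gens R B \<equiv>
     {frag_of (r \<oplus>\<^bsub>R\<^esub> s, b) - frag_of (r, b) - frag_of (s, b)
       | r s b. r \<in> carrier R \<and> s \<in> carrier R \<and> b \<in> carrier B} \<union>
     {frag_of (r, b \<otimes>\<^bsub>B\<^esub> c) - frag_of (r, b) - frag_of (r, c)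
       | r b c. r \<in> carrier R \<and> b \<in> carrier B \<and> c \<in> carrier B}"

lemma tensor_gens_keys:
  assumes "cring R" "comm_group B"
  shows "tensor_gens R B \<subseteq> {x. Poly_Mapping.keys x \<subseteq> carrier R \<times> carrier B}"
proof -
  interpret R: cring R by fact
  interpret B: comm_group B by fact
  show ?thesis
    by (rule subsetI, rule CollectI, elim UnE CollectE exE conjE; hypsubst;
      intro keys_diff_subset) auto
qed

lemma subgroup_tensor_relations:
  assumes "cring R" "comm_group B"
  shows "subgroup (tensor_relations R B) (free_Abelian_group (carrier R \<times> carrier B))"
  unfolding tensor_relations_def free_pairs_def
  by (rule subgroup_generate_free[OF tensor_gens_keys[OF assms]])

lemma tensor_relations_add:
  assumes "r \<in> carrier R" "s \<in> carrier R" "b \<in> carrier B"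
  shows "frag_of (r \<oplus>\<^bsub>R\<^esub> s, b) - frag_of (r, b) - frag_of (s, b) \<in> tensor_relations R B"
  unfolding tensor_relations_def using assms by (intro generate.incl) blast

lemma tensor_relations_mult:
  assumes "r \<in> carrier R" "b \<in> carrier B" "c \<in> carrier B"
  shows "frag_of (r, b \<otimes>\<^bsub>B\<^esub> c) - frag_of (r, b) - frag_of (r, c) \<in> tensor_relations R B"
  unfolding tensor_relations_def using assms by (intro generate.incl) blast

lemma pure_tensor_mult:
  assumes "cring R" "comm_group B" "r \<in> carrier R" "b \<in> carrier B" "c \<in> carrier B"
  shows "pure_tensor R B r b \<oplus>\<^bsub>scalar_ext R B\<^esub> pure_tensor R B r c = pure_tensor R B r (b \<otimes>\<^bsub>B\<^esub> c)"
proof -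
  note sub = subgroup_tensor_relations[OF assms(1,2)]
  have "frag_of (r, b) + frag_of (r, c) - frag_of (r, b \<otimes>\<^bsub>B\<^esub> c) \<in> tensor_relations R B"
    using subgroup_free_uminus[OF sub tensor_relations_mult[OF assms(3-5)]]
    by (simp add: algebra_simps)
  then show ?thesis
    by (simp add: pure_tensor_def scalar_ext_def free_pairs_def rcos_free_mult[OF sub]
        rcos_free_eqI[OF sub])
qed

lemma pure_tensor_one:
  assumes "cring R" "comm_group B" "r \<in> carrier R"
  shows "pure_tensor R B r \<one>\<^bsub>B\<^esub> = \<zero>\<^bsub>scalar_ext R B\<^esub>"
proof -
  interpret B: comm_group B by fact
  note sub = subgroup_tensor_relations[OF assms(1,2)]
  \<comment> \<open>The relation for the product of the identity with itself is minus the generator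
    \<open>(r, 1)\<close>.\<close>
  have "frag_of (r, \<one>\<^bsub>B\<^esub>) - 0 \<in> tensor_relations R B"
    using subgroup_free_uminus[OF sub tensor_relations_mult[of r R "\<one>\<^bsub>B\<^esub>" B "\<one>\<^bsub>B\<^esub>"]] assms(3)
    by simp
  from rcos_free_eqI[OF sub this] show ?thesis
    by (simp add: pure_tensor_def scalar_ext_def free_pairs_def rcos_free)
qed

lemma pure_tensor_closed:
  "r \<in> carrier R \<Longrightarrow> b \<in> carrier B \<Longrightarrow> pure_tensor R B r b \<in> carrier (scalar_ext R B)"
  by (auto simp: pure_tensor_def scalar_ext_def free_pairs_def carrier_Mod_free keys_frag_of)

text \<open>The additive part of the module record is the commutative quotient group in additive
  notation; this is the structure over which \<open>finsum\<close> is taken.\<close>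

lemma abelian_monoid_scalar_ext:
  assumes "cring R" "comm_group B"
  shows "abelian_monoid (scalar_ext R B)"
proof -
  interpret Q: comm_group "free_pairs R B Mod tensor_relations R B"
    unfolding free_pairs_def
    by (rule comm_group_Mod_free[OF subgroup_tensor_relations[OF assms]])
  show ?thesis
    by (rule abelian_monoidI)
      (simp_all add: scalar_ext_def Q.m_closed Q.m_ac del: mult_FactGroup one_FactGroup)
qed

section \<open>Biadditivity of the composition and its extension to the tensor product\<close>

context three_groups begin

abbreviation "bcomp \<equiv> burnside_comp (G, X, aX) (H, Y, aY) (K, Z, aZ)"

lemma bcomp_closed:
  assumes "b \<in> carrier (burnside ZY)" "c \<in> carrier (burnside YX)"
  shows "bcomp b c \<in> carrier (burnside ZX)"
proof -
  obtain b' c' where b: "b = coprod_relations ZY #>\<^bsub>free_classes ZY\<^esub> b'"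
      "Poly_Mapping.keys b' \<subseteq> iso_classes ZY"
    and c: "c = coprod_relations YX #>\<^bsub>free_classes YX\<^esub> c'"
      "Poly_Mapping.keys c' \<subseteq> iso_classes YX"
    using assms unfolding carrier_burnside by blast
  have "Poly_Mapping.keys (frag_extend2 icomp b' c') \<subseteq> iso_classes ZX"
    by (rule keys_frag_extend2[OF icomp_keys b(2) c(2)])
  then show ?thesis
    unfolding b(1) c(1) burnside_comp_cosets[OF b(2) c(2)] carrier_burnside by blast
qed

text \<open>The product of cosets is the coset of the sum of formal sums, and composition of formal
  sums is biadditive. In this multiplicative form it matches the second family of tensor
  relations.\<close>

lemma bcomp_mult_left:
  assumes "b \<in> carrier (burnside ZY)" "b' \<in> carrier (burnside ZY)" "c \<in> carrier (burnside YX)"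
  shows "bcomp (b \<otimes>\<^bsub>burnside ZY\<^esub> b') c = bcomp b c \<otimes>\<^bsub>burnside ZX\<^esub> bcomp b' c"
proof -
  obtain d d' e where d: "b = coprod_relations ZY #>\<^bsub>free_classes ZY\<^esub> d"
      "Poly_Mapping.keys d \<subseteq> iso_classes ZY"
    and d': "b' = coprod_relations ZY #>\<^bsub>free_classes ZY\<^esub> d'"
      "Poly_Mapping.keys d' \<subseteq> iso_classes ZY"
    and e: "c = coprod_relations YX #>\<^bsub>free_classes YX\<^esub> e"
      "Poly_Mapping.keys e \<subseteq> iso_classes YX"
    using assms unfolding carrier_burnside by blast
  have dd': "Poly_Mapping.keys (d + d') \<subseteq> iso_classes ZY"
    using d(2) d'(2) keys_add[of d d'] by blast
  show ?thesis
    unfolding d(1) d'(1) e(1) burnside_mult[OF grp(1)] burnside_comp_cosets[OF d(2) e(2)]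
      burnside_comp_cosets[OF d'(2) e(2)] burnside_comp_cosets[OF dd' e(2)]
      burnside_mult[OF grp(3)] frag_extend2_add ..
qed

lemma bcomp_mult_right:
  assumes "b \<in> carrier (burnside ZY)" "c \<in> carrier (burnside YX)" "c' \<in> carrier (burnside YX)"
  shows "bcomp b (c \<otimes>\<^bsub>burnside YX\<^esub> c') = bcomp b c \<otimes>\<^bsub>burnside ZX\<^esub> bcomp b c'"
proof -
  obtain d e e' where d: "b = coprod_relations ZY #>\<^bsub>free_classes ZY\<^esub> d"
      "Poly_Mapping.keys d \<subseteq> iso_classes ZY"
    and e: "c = coprod_relations YX #>\<^bsub>free_classes YX\<^esub> e"
      "Poly_Mapping.keys e \<subseteq> iso_classes YX"
    and e': "c' = coprod_relations YX #>\<^bsub>free_classes YX\<^esub> e'"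
      "Poly_Mapping.keys e' \<subseteq> iso_classes YX"
    using assms unfolding carrier_burnside by blast
  have ee': "Poly_Mapping.keys (e + e') \<subseteq> iso_classes YX"
    using e(2) e'(2) keys_add[of e e'] by blast
  show ?thesis
    unfolding d(1) e(1) e'(1) burnside_mult[OF grp(2)] burnside_comp_cosets[OF d(2) e(2)]
      burnside_comp_cosets[OF d(2) e'(2)] burnside_comp_cosets[OF d(2) ee']
      burnside_mult[OF grp(3)] frag_extend2_add ..
qed

text \<open>The second use of \<open>frag_extend2_cosets\<close>, with pairs of a scalar and a
  Burnside element as basis. Relations additive in the scalar are preserved by distributivity in
  \<open>R\<close>, those additive in the element by biadditivity of \<open>bcomp\<close>.\<close>

lemma comp_CR_pure_tensor:
  assumes R: "cring R" and r: "r \<in> carrier R" and s: "s \<in> carrier R"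
    and b: "b \<in> carrier (burnside ZY)" and c: "c \<in> carrier (burnside YX)"
  shows "comp_CR R (G, X, aX) (H, Y, aY) (K, Z, aZ)
      (pure_tensor R (burnside ZY) r b) (pure_tensor R (burnside YX) s c)
    = pure_tensor R (burnside ZX) (r \<otimes>\<^bsub>R\<^esub> s) (bcomp b c)"
proof -
  interpret R: cring R by fact
  note cg = comm_group_burnside[OF grp(1)] comm_group_burnside[OF grp(2)]
    comm_group_burnside[OF grp(3)]
  define \<phi> where "\<phi> = (\<lambda>(r, b) (s, c). frag_of (r \<otimes>\<^bsub>R\<^esub> s, bcomp b c))"
  have \<phi>: "\<phi> (r, b) (s, c) = frag_of (r \<otimes>\<^bsub>R\<^esub> s, bcomp b c)" for r b s c
    by (simp add: \<phi>_def)
  let ?N = "tensor_relations R (burnside ZX)"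
  have left: "frag_extend2 \<phi> x (frag_of j) \<in> ?N"
    if x: "x \<in> tensor_gens R (burnside ZY)" and j: "j \<in> carrier R \<times> carrier (burnside YX)" for x j
  proof -
    obtain s c where j: "j = (s, c)" "s \<in> carrier R" "c \<in> carrier (burnside YX)"
      using j by blast
    from x show ?thesis
    proof (elim UnE CollectE exE conjE)
      fix r r' b assume "x = frag_of (r \<oplus>\<^bsub>R\<^esub> r', b) - frag_of (r, b) - frag_of (r', b)"
        and "r \<in> carrier R" "r' \<in> carrier R" "b \<in> carrier (burnside ZY)"
      then show ?thesis
        using tensor_relations_add[of "r \<otimes>\<^bsub>R\<^esub> s" R "r' \<otimes>\<^bsub>R\<^esub> s" "bcomp b c" "burnside ZX"] j
          bcomp_closed
        by (simp add: j(1) frag_extend2_diff \<phi> R.l_distr del: prod_gset.simps)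
    next
      fix r b b' assume "x = frag_of (r, b \<otimes>\<^bsub>burnside ZY\<^esub> b') - frag_of (r, b) - frag_of (r, b')"
        and "r \<in> carrier R" "b \<in> carrier (burnside ZY)" "b' \<in> carrier (burnside ZY)"
      then show ?thesis
        using tensor_relations_mult[of "r \<otimes>\<^bsub>R\<^esub> s" R "bcomp b c" "burnside ZX" "bcomp b' c"] j
          bcomp_closed
        by (simp add: j(1) frag_extend2_diff \<phi> bcomp_mult_left del: prod_gset.simps)
    qed
  qed
  have right: "frag_extend2 \<phi> (frag_of i) x \<in> ?N"
    if i: "i \<in> carrier R \<times> carrier (burnside ZY)" and x: "x \<in> tensor_gens R (burnside YX)" for x i
  proof -
    obtain r b where i: "i = (r, b)" "r \<in> carrier R" "b \<in> carrier (burnside ZY)"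
      using i by blast
    from x show ?thesis
    proof (elim UnE CollectE exE conjE)
      fix s s' c assume "x = frag_of (s \<oplus>\<^bsub>R\<^esub> s', c) - frag_of (s, c) - frag_of (s', c)"
        and "s \<in> carrier R" "s' \<in> carrier R" "c \<in> carrier (burnside YX)"
      then show ?thesis
        using tensor_relations_add[of "r \<otimes>\<^bsub>R\<^esub> s" R "r \<otimes>\<^bsub>R\<^esub> s'" "bcomp b c" "burnside ZX"] i
          bcomp_closed
        by (simp add: i(1) frag_extend2_diff \<phi> R.r_distr del: prod_gset.simps)
    next
      fix s c c' assume "x = frag_of (s, c \<otimes>\<^bsub>burnside YX\<^esub> c') - frag_of (s, c) - frag_of (s, c')"
        and "s \<in> carrier R" "c \<in> carrier (burnside YX)" "c' \<in> carrier (burnside YX)"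
      then show ?thesis
        using tensor_relations_mult[of "r \<otimes>\<^bsub>R\<^esub> s" R "bcomp b c" "burnside ZX" "bcomp b c'"] i
          bcomp_closed
        by (simp add: i(1) frag_extend2_diff \<phi> bcomp_mult_right del: prod_gset.simps)
    qed
  qed
  have k: "Poly_Mapping.keys (frag_of (r, b)) \<subseteq> carrier R \<times> carrier (burnside ZY)"
    "Poly_Mapping.keys (frag_of (s, c)) \<subseteq> carrier R \<times> carrier (burnside YX)"
    using r s b c by (simp_all add: keys_frag_of del: prod_gset.simps)
  have \<phi>_fold: "frag_extend (\<lambda>(r, b). frag_extend (\<lambda>(s, b'). frag_of (r \<otimes>\<^bsub>R\<^esub> s, bcomp b b')) n) m
      = frag_extend2 \<phi> m n" for m n
    by (simp add: frag_extend2_def \<phi>_def split_beta' del: prod_gset.simps)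
  have "frag_of (r \<otimes>\<^bsub>R\<^esub> s, bcomp b c) = frag_extend2 \<phi> (frag_of (r, b)) (frag_of (s, c))"
    by (simp add: \<phi> del: prod_gset.simps)
  then show ?thesis
    unfolding comp_CR_def pure_tensor_def free_pairs_def Let_def \<phi>_fold
    by (simp only:) (rule frag_extend2_cosets[OF tensor_relations_def[unfolded free_pairs_def]
          tensor_gens_keys[OF R cg(1)] tensor_relations_def[unfolded free_pairs_def]
          tensor_gens_keys[OF R cg(2)] subgroup_tensor_relations[OF R cg(3)] left right k])
qed

end

lemma burnside_class_closed:
  assumes "group (fst Z)" "acts_over Z S"
  shows "burnside_class Z S \<in> carrier (burnside Z)"
  using iso_class_in[OF assms] unfolding carrier_burnside burnside_class_def
  by (force simp only: mem_Collect_eq keys_frag_of)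

text \<open>Here the levels meet: the scalars multiply to one, the formal sums are single
  generators, and \<open>iso_class_comp_eq\<close> evaluates the composite of classes. What remains
  afterwards is the geometry of one set of orbits.\<close>

lemma (in composable_spans) comp_CR_burnside_class:
  assumes R: "cring R"
  shows "comp_CR R (G, X, aX) (H, Y, aY) (K, Z, aZ)
      (pure_tensor R (burnside (prod_gset (K, Z, aZ) (H, Y, aY))) \<one>\<^bsub>R\<^esub>
        (burnside_class (prod_gset (K, Z, aZ) (H, Y, aY)) (V, b, \<phi>)))
      (pure_tensor R (burnside (prod_gset (H, Y, aY) (G, X, aX))) \<one>\<^bsub>R\<^esub>
        (burnside_class (prod_gset (H, Y, aY) (G, X, aX)) (U, a, \<psi>)))
    = pure_tensor R (burnside (prod_gset (K, Z, aZ) (G, X, aX))) \<one>\<^bsub>R\<^esub>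
        (burnside_class (prod_gset (K, Z, aZ) (G, X, aX))
          (orb ` pairs, comp_act K H G b a, comp_map \<phi> \<psi>))"
proof -
  interpret R: cring R by fact
  interpret T: three_groups K H G Z Y X aZ aY aX
    by (rule three_groups.intro[OF group_K group_H group_G])
  note V = iso_class_in[OF T.grp(1) acts_V] and U = iso_class_in[OF T.grp(2) acts_U]
  have k: "Poly_Mapping.keys (frag_of (iso_class T.ZY (V, b, \<phi>))) \<subseteq> iso_classes T.ZY"
    "Poly_Mapping.keys (frag_of (iso_class T.YX (U, a, \<psi>))) \<subseteq> iso_classes T.YX"
    using V U by (simp_all only: keys_frag_of insert_subset empty_subsetI simp_thms)
  show ?thesis
    unfolding T.comp_CR_pure_tensor[OF R R.one_closed R.one_closed
        burnside_class_closed[OF T.grp(1) acts_V] burnside_class_closed[OF T.grp(2) acts_U]]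
    unfolding burnside_class_def T.burnside_comp_cosets[OF k] frag_extend2_of iso_class_comp_eq
    by (simp only: R.l_one R.one_closed)
qed

text \<open>Tensoring with the scalar one is additive. A sum in the morphism module can thus be
  replaced by a sum of free generators, where the coproduct relations are available.\<close>

lemma finsum_burnside_class:
  assumes R: "cring R" and Z: "group (fst Z)" and "finite I"
    and "\<And>i. i \<in> I \<Longrightarrow> x i \<in> iso_classes Z"
  defines "p \<equiv> \<lambda>c. pure_tensor R (burnside Z) \<one>\<^bsub>R\<^esub> (coprod_relations Z #>\<^bsub>free_classes Z\<^esub> c)"
  shows "(\<Oplus>\<^bsub>scalar_ext R (burnside Z)\<^esub>i\<in>I. p (frag_of (x i))) = p (\<Sum>i\<in>I. frag_of (x i))"
  using assms(3,4)
proof (induction I rule: finite_induct)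
  case empty
  interpret M: abelian_monoid "scalar_ext R (burnside Z)"
    by (rule abelian_monoid_scalar_ext[OF R comm_group_burnside[OF Z]])
  interpret R: cring R by fact
  have "\<one>\<^bsub>burnside Z\<^esub> = coprod_relations Z #>\<^bsub>free_classes Z\<^esub> 0"
    by (simp add: burnside_def free_classes_def rcos_free)
  then show ?case
    using pure_tensor_one[OF R comm_group_burnside[OF Z] R.one_closed] by (simp add: p_def)
next
  case (insert i I)
  interpret M: abelian_monoid "scalar_ext R (burnside Z)"
    by (rule abelian_monoid_scalar_ext[OF R comm_group_burnside[OF Z]])
  interpret R: cring R by fact
  have mem: "coprod_relations Z #>\<^bsub>free_classes Z\<^esub> frag_of (x j) \<in> carrier (burnside Z)"
    if "j \<in> insert i I" for j
    using insert.prems[OF that] unfolding carrier_burnside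
    by (force simp only: mem_Collect_eq keys_frag_of)
  have "Poly_Mapping.keys (\<Sum>i\<in>I. frag_of (x i)) \<subseteq> iso_classes Z"
    using sum_closed_free_Abelian_group[of I "\<lambda>i. frag_of (x i)" "iso_classes Z"] insert.prems
    by (simp add: keys_frag_of)
  then have mem': "coprod_relations Z #>\<^bsub>free_classes Z\<^esub> (\<Sum>i\<in>I. frag_of (x i))
      \<in> carrier (burnside Z)"
    unfolding carrier_burnside by blast
  have "p (frag_of (x j)) \<in> carrier (scalar_ext R (burnside Z))" if "j \<in> insert i I" for j
    unfolding p_def by (rule pure_tensor_closed[OF R.one_closed mem[OF that]])
  then have "(\<Oplus>\<^bsub>scalar_ext R (burnside Z)\<^esub>i\<in>insert i I. p (frag_of (x i)))
      = p (frag_of (x i)) \<oplus>\<^bsub>scalar_ext R (burnside Z)\<^esub> p (\<Sum>i\<in>I. frag_of (x i))"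
    using insert by (subst M.finsum_insert) auto
  also have "\<dots> = p (frag_of (x i) + (\<Sum>i\<in>I. frag_of (x i)))"
    using mem' mem unfolding p_def burnside_mult[OF Z, symmetric]
    by (intro pure_tensor_mult[OF R comm_group_burnside[OF Z] R.one_closed]) auto
  finally show ?case using insert.hyps by simp
qed

section \<open>Composition of transitive spans\<close>

lemma l_coset_eq_iff:
  fixes G (structure)
  assumes "group G" "subgroup D G" "x \<in> carrier G" "y \<in> carrier G"
  shows "x <# D = y <# D \<longleftrightarrow> inv x \<otimes> y \<in> D"
proof -
  interpret group G by fact
  interpret D: subgroup D G by fact
  have *: "y <# D \<subseteq> x <# D" if "x \<in> carrier G" "y \<in> carrier G" "inv x \<otimes> y \<in> D" for x y
  proof
    fix z assume "z \<in> y <# D"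
    then obtain d where d: "d \<in> D" "z = y \<otimes> d" by (auto simp: l_coset_def)
    have "z = x \<otimes> ((inv x \<otimes> y) \<otimes> d)"
      using that d D.mem_carrier[OF d(1)] by (simp add: m_assoc[symmetric])
    moreover have "(inv x \<otimes> y) \<otimes> d \<in> D" using that(3) d(1) by (rule D.m_closed)
    ultimately show "z \<in> x <# D" unfolding l_coset_def by blast
  qed
  show ?thesis
  proof
    assume "x <# D = y <# D"
    then have "y \<in> x <# D" using lcos_self[OF assms(4,2)] by simp
    then show "inv x \<otimes> y \<in> D" by (rule D.lcos_module_imp[OF assms(1,3)])
  next
    assume xy: "inv x \<otimes> y \<in> D"
    then have "inv y \<otimes> x \<in> D"
      using D.m_inv_closed[OF xy] assms by (simp add: inv_mult_group)
    then show "x <# D = y <# D" using * xy assms by blast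
  qed
qed

lemma coset_act_l_coset:
  fixes G (structure)
  assumes "group G" "subgroup D G" "x \<in> carrier G" "y \<in> carrier G"
  shows "coset_act G D x (y <# D) = (x \<otimes> y) <# D"
proof -
  interpret group G by fact
  have "y <# D \<in> lcosets D" using assms by (auto simp: LCOSETS_def)
  then show ?thesis
    using assms subgroup.subset[OF assms(2)] by (simp add: coset_act_def lcos_m_assoc)
qed

lemma mem_conj_subgroup:
  fixes G (structure)
  assumes "group G" "subgroup D G" "x \<in> carrier G" "y \<in> carrier G"
  shows "y \<in> conj_subgroup G x D \<longleftrightarrow> inv x \<otimes> y \<otimes> x \<in> D"
proof -
  interpret group G by fact
  interpret D: subgroup D G by fact
  have "y \<in> conj_subgroup G x D \<longleftrightarrow> (\<exists>d\<in>D. y = x \<otimes> d \<otimes> inv x)"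
    by (auto simp: conj_subgroup_def l_coset_def r_coset_def)
  also have "\<dots> \<longleftrightarrow> (\<exists>d\<in>D. inv x \<otimes> y \<otimes> x = d)"
  proof (rule bex_cong[OF refl])
    fix d assume "d \<in> D"
    then have d: "d \<in> carrier G" by (rule D.mem_carrier)
    have "inv x \<otimes> (x \<otimes> d \<otimes> inv x) \<otimes> x = d" "x \<otimes> (inv x \<otimes> y \<otimes> x) \<otimes> inv x = y"
      using assms d by (simp_all add: m_assoc) (simp_all add: m_assoc[symmetric])
    then show "y = x \<otimes> d \<otimes> inv x \<longleftrightarrow> inv x \<otimes> y \<otimes> x = d" by auto
  qed
  finally show ?thesis by blast
qed

text \<open>The hypothesis \<open>base\<close> says that the pair of trivial cosets lies in the
  fibre product.\<close>

locale coset_spans = three_groups K H G Z Y X aZ aY aX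
  for K :: "'k monoid" and H :: "'h monoid" and G :: "'g monoid"
    and Z :: "'z set" and Y :: "'y set" and X :: "'x set"
    and aZ :: "'k \<Rightarrow> 'z \<Rightarrow> 'z" and aY :: "'h \<Rightarrow> 'y \<Rightarrow> 'y" and aX :: "'g \<Rightarrow> 'x \<Rightarrow> 'x" +
  fixes D :: "('h \<times> 'g) set" and E :: "('k \<times> 'h) set"
    and \<beta> :: "('h \<times> 'g) set \<Rightarrow> 'y" and \<alpha> :: "('h \<times> 'g) set \<Rightarrow> 'x"
    and \<delta> :: "('k \<times> 'h) set \<Rightarrow> 'z" and \<gamma> :: "('k \<times> 'h) set \<Rightarrow> 'y"
  assumes D: "subgroup D (H \<times>\<times> G)" and E: "subgroup E (K \<times>\<times> H)"
    and acts_E: "acts_over ZY (lcosets\<^bsub>K \<times>\<times> H\<^esub> E, coset_act (K \<times>\<times> H) E, \<lambda>v. (\<delta> v, \<gamma> v))"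
    and acts_D: "acts_over YX (lcosets\<^bsub>H \<times>\<times> G\<^esub> D, coset_act (H \<times>\<times> G) D, \<lambda>u. (\<beta> u, \<alpha> u))"
    and base: "\<beta> D = \<gamma> E"
begin

sublocale composable_spans K H G Z Y X aZ aY aX
  "lcosets\<^bsub>K \<times>\<times> H\<^esub> E" "coset_act (K \<times>\<times> H) E" "\<lambda>v. (\<delta> v, \<gamma> v)"
  "lcosets\<^bsub>H \<times>\<times> G\<^esub> D" "coset_act (H \<times>\<times> G) D" "\<lambda>u. (\<beta> u, \<alpha> u)"
  by (rule composableI[OF acts_E acts_D])

sublocale KH: group "K \<times>\<times> H" by (rule DirProd_group[OF group_K group_H])
sublocale HG: group "H \<times>\<times> G" by (rule DirProd_group[OF group_H group_G])
sublocale KG: group "K \<times>\<times> G" by (rule DirProd_group[OF group_K group_G])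
sublocale D: subgroup D "H \<times>\<times> G" by (rule D)
sublocale E: subgroup E "K \<times>\<times> H" by (rule E)

abbreviation cE :: "'k \<Rightarrow> 'h \<Rightarrow> ('k \<times> 'h) set" where "cE k h \<equiv> (k, h) <#\<^bsub>K \<times>\<times> H\<^esub> E"
abbreviation cD :: "'h \<Rightarrow> 'g \<Rightarrow> ('h \<times> 'g) set" where "cD h g \<equiv> (h, g) <#\<^bsub>H \<times>\<times> G\<^esub> D"
abbreviation "stab \<equiv> stabilizer H aY (\<beta> D)"

definition star :: "'h \<Rightarrow> ('k \<times> 'g) set" where
  "star h = star_prod H K G E (conj_subgroup (H \<times>\<times> G) (h, \<one>\<^bsub>G\<^esub>) D)"

lemma E_mem: "(k, h) \<in> E \<Longrightarrow> k \<in> carrier K \<and> h \<in> carrier H"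
  using E.mem_carrier by auto

lemma D_mem: "(h, g) \<in> D \<Longrightarrow> h \<in> carrier H \<and> g \<in> carrier G"
  using D.mem_carrier by auto

lemma cE_one: "cE \<one>\<^bsub>K\<^esub> \<one>\<^bsub>H\<^esub> = E"
  using KH.lcos_mult_one[OF E.subset] by simp

lemma cD_one: "cD \<one>\<^bsub>H\<^esub> \<one>\<^bsub>G\<^esub> = D"
  using HG.lcos_mult_one[OF D.subset] by simp

lemma cE_in: "k \<in> carrier K \<Longrightarrow> h \<in> carrier H \<Longrightarrow> cE k h \<in> lcosets\<^bsub>K \<times>\<times> H\<^esub> E"
  by (auto simp: LCOSETS_def)

lemma cD_in: "h \<in> carrier H \<Longrightarrow> g \<in> carrier G \<Longrightarrow> cD h g \<in> lcosets\<^bsub>H \<times>\<times> G\<^esub> D"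
  by (auto simp: LCOSETS_def)

lemma cE_act:
  "k \<in> carrier K \<Longrightarrow> h \<in> carrier H \<Longrightarrow> k' \<in> carrier K \<Longrightarrow> h' \<in> carrier H \<Longrightarrow>
     coset_act (K \<times>\<times> H) E (k, h) (cE k' h') = cE (k \<otimes>\<^bsub>K\<^esub> k') (h \<otimes>\<^bsub>H\<^esub> h')"
  using coset_act_l_coset[OF KH.is_group E, of "(k, h)" "(k', h')"] by simp

lemma cD_act:
  "h \<in> carrier H \<Longrightarrow> g \<in> carrier G \<Longrightarrow> h' \<in> carrier H \<Longrightarrow> g' \<in> carrier G \<Longrightarrow>
     coset_act (H \<times>\<times> G) D (h, g) (cD h' g') = cD (h \<otimes>\<^bsub>H\<^esub> h') (g \<otimes>\<^bsub>G\<^esub> g')"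
  using coset_act_l_coset[OF HG.is_group D, of "(h, g)" "(h', g')"] by simp

lemma cE_eq_iff:
  "k \<in> carrier K \<Longrightarrow> h \<in> carrier H \<Longrightarrow> k' \<in> carrier K \<Longrightarrow> h' \<in> carrier H \<Longrightarrow>
     cE k h = cE k' h' \<longleftrightarrow> (inv\<^bsub>K\<^esub> k \<otimes>\<^bsub>K\<^esub> k', inv\<^bsub>H\<^esub> h \<otimes>\<^bsub>H\<^esub> h') \<in> E"
  using l_coset_eq_iff[OF KH.is_group E, of "(k, h)" "(k', h')"]
  by (simp add: inv_DirProd[OF group_K group_H])

lemma cD_eq_iff:
  "h \<in> carrier H \<Longrightarrow> g \<in> carrier G \<Longrightarrow> h' \<in> carrier H \<Longrightarrow> g' \<in> carrier G \<Longrightarrow>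
     cD h g = cD h' g' \<longleftrightarrow> (inv\<^bsub>H\<^esub> h \<otimes>\<^bsub>H\<^esub> h', inv\<^bsub>G\<^esub> g \<otimes>\<^bsub>G\<^esub> g') \<in> D"
  using l_coset_eq_iff[OF HG.is_group D, of "(h, g)" "(h', g')"]
  by (simp add: inv_DirProd[OF group_H group_G])

lemma cE_absorb: "(k, h) \<in> E \<Longrightarrow> cE k h = E"
  using cE_eq_iff[of "\<one>\<^bsub>K\<^esub>" "\<one>\<^bsub>H\<^esub>" k h] E_mem[of k h] by (simp add: cE_one)

lemma cD_absorb: "(h, g) \<in> D \<Longrightarrow> cD h g = D"
  using cD_eq_iff[of "\<one>\<^bsub>H\<^esub>" "\<one>\<^bsub>G\<^esub>" h g] D_mem[of h g] by (simp add: cD_one)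

text \<open>Equivariance at the trivial coset. By \<open>base\<close> the leg \<gamma> is expressed
  through \<beta> D as well, so the fibre condition compares two translates of one point of
  \<open>Y\<close>.\<close>

lemma cE_maps:
  assumes "k \<in> carrier K" "h \<in> carrier H"
  shows "\<delta> (cE k h) = aZ k (\<delta> E)" "\<gamma> (cE k h) = aY h (\<beta> D)"
  using V_facts(4)[OF cE_in assms, of "\<one>\<^bsub>K\<^esub>" "\<one>\<^bsub>H\<^esub>"] cE_act[OF assms, of "\<one>\<^bsub>K\<^esub>" "\<one>\<^bsub>H\<^esub>"] assms
  by (simp_all add: cE_one base)

lemma cD_maps:
  assumes "h \<in> carrier H" "g \<in> carrier G"
  shows "\<beta> (cD h g) = aY h (\<beta> D)" "\<alpha> (cD h g) = aX g (\<alpha> D)"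
  using U_facts(4)[OF cD_in assms, of "\<one>\<^bsub>H\<^esub>" "\<one>\<^bsub>G\<^esub>"] cD_act[OF assms, of "\<one>\<^bsub>H\<^esub>" "\<one>\<^bsub>G\<^esub>"] assms
  by (simp_all add: cD_one)

text \<open>At the base values multiplicativity is inherited from the coset actions: both sides are
  the value of an equivariant leg at the same coset.\<close>

lemma base_act_mult:
  "k \<in> carrier K \<Longrightarrow> k' \<in> carrier K \<Longrightarrow> aZ (k \<otimes>\<^bsub>K\<^esub> k') (\<delta> E) = aZ k (aZ k' (\<delta> E))"
  "h \<in> carrier H \<Longrightarrow> h' \<in> carrier H \<Longrightarrow> aY (h \<otimes>\<^bsub>H\<^esub> h') (\<beta> D) = aY h (aY h' (\<beta> D))"
  "g \<in> carrier G \<Longrightarrow> g' \<in> carrier G \<Longrightarrow> aX (g \<otimes>\<^bsub>G\<^esub> g') (\<alpha> D) = aX g (aX g' (\<alpha> D))"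
proof -
  show "aZ (k \<otimes>\<^bsub>K\<^esub> k') (\<delta> E) = aZ k (aZ k' (\<delta> E))" if "k \<in> carrier K" "k' \<in> carrier K" for k k'
    using V_facts(4)[OF cE_in[of k' "\<one>\<^bsub>H\<^esub>"], of k "\<one>\<^bsub>H\<^esub>"] that by (simp add: cE_act cE_maps)
  show "aY (h \<otimes>\<^bsub>H\<^esub> h') (\<beta> D) = aY h (aY h' (\<beta> D))" if "h \<in> carrier H" "h' \<in> carrier H" for h h'
    using U_facts(4)[OF cD_in[of h' "\<one>\<^bsub>G\<^esub>"], of h "\<one>\<^bsub>G\<^esub>"] that by (simp add: cD_act cD_maps)
  show "aX (g \<otimes>\<^bsub>G\<^esub> g') (\<alpha> D) = aX g (aX g' (\<alpha> D))" if "g \<in> carrier G" "g' \<in> carrier G" for g g'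
    using U_facts(4)[OF cD_in[of "\<one>\<^bsub>H\<^esub>" g'], of "\<one>\<^bsub>H\<^esub>" g] that by (simp add: cD_act cD_maps)
qed

lemma base_act_one: "aY \<one>\<^bsub>H\<^esub> (\<beta> D) = \<beta> D"
  using cD_maps(1)[of "\<one>\<^bsub>H\<^esub>" "\<one>\<^bsub>G\<^esub>"] by (simp add: cD_one)

text \<open>Conjugation by \<open>(h, 1)\<close> leaves the second component as it is, so only y
  becomes inv h y h. This is the form that \<open>point_eq_cact_iff\<close> produces.\<close>

lemma star_iff:
  assumes "h \<in> carrier H"
  shows "(k, g) \<in> star h \<longleftrightarrow>
    (\<exists>y. (k, y) \<in> E \<and> (inv\<^bsub>H\<^esub> h \<otimes>\<^bsub>H\<^esub> y \<otimes>\<^bsub>H\<^esub> h, g) \<in> D)"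
proof -
  have "(y, g) \<in> conj_subgroup (H \<times>\<times> G) (h, \<one>\<^bsub>G\<^esub>) D
      \<longleftrightarrow> (inv\<^bsub>H\<^esub> h \<otimes>\<^bsub>H\<^esub> y \<otimes>\<^bsub>H\<^esub> h, g) \<in> D"
    if "y \<in> carrier H" "g \<in> carrier G" for y
    using mem_conj_subgroup[OF HG.is_group D, of "(h, \<one>\<^bsub>G\<^esub>)" "(y, g)"] that assms
    by (simp add: inv_DirProd[OF group_H group_G])
  then show ?thesis
    using E_mem D_mem by (auto simp: star_def star_prod_def)
qed

lemma one_star: "h \<in> carrier H \<Longrightarrow> (\<one>\<^bsub>K\<^esub>, \<one>\<^bsub>G\<^esub>) \<in> star h"
  using E.one_closed D.one_closed by (force simp: star_iff)

text \<open>An element of \<open>E\<close> fixes the trivial coset of \<open>E\<close>, so its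
  component in \<open>K\<close> fixes \<delta> E; likewise for \<open>D\<close> and \<alpha> D. This
  makes the two coset maps single valued.\<close>

lemma star_fixes:
  assumes "h \<in> carrier H" "(k, g) \<in> star h"
  shows "k \<in> carrier K" "g \<in> carrier G" "aZ k (\<delta> E) = \<delta> E" "aX g (\<alpha> D) = \<alpha> D"
proof -
  obtain y where y: "(k, y) \<in> E" "(inv\<^bsub>H\<^esub> h \<otimes>\<^bsub>H\<^esub> y \<otimes>\<^bsub>H\<^esub> h, g) \<in> D"
    using assms star_iff by blast
  show "k \<in> carrier K" "g \<in> carrier G" using y E_mem D_mem by blast+
  show "aZ k (\<delta> E) = \<delta> E" using cE_maps(1) cE_absorb[OF y(1)] E_mem[OF y(1)] by metis
  show "aX g (\<alpha> D) = \<alpha> D" using cD_maps(2) cD_absorb[OF y(2)] D_mem[OF y(2)] by metis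
qed

lemma coset_maps:
  assumes h: "h \<in> carrier H" and k: "k \<in> carrier K" and g: "g \<in> carrier G"
  shows "coset_map_fst aZ (\<delta> E) ((k, g) <#\<^bsub>K \<times>\<times> G\<^esub> star h) = aZ k (\<delta> E)"
    "coset_map_snd aX (\<alpha> D) ((k, g) <#\<^bsub>K \<times>\<times> G\<^esub> star h) = aX g (\<alpha> D)"
proof -
  \<comment> \<open>\<open>the_elem\<close> needs a nonempty set of values besides a constant
    one.\<close>
  have ne: "star h \<noteq> {}" using one_star[OF h] by blast
  have C: "(k, g) <#\<^bsub>K \<times>\<times> G\<^esub> star h = (\<lambda>(k', g'). (k \<otimes>\<^bsub>K\<^esub> k', g \<otimes>\<^bsub>G\<^esub> g')) ` star h"
    by (auto simp: l_coset_def)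
  have "(\<lambda>(k, g). aZ k (\<delta> E)) ` (\<lambda>(k', g'). (k \<otimes>\<^bsub>K\<^esub> k', g \<otimes>\<^bsub>G\<^esub> g')) ` star h
      = (\<lambda>_. aZ k (\<delta> E)) ` star h"
    unfolding image_image
    by (rule image_cong[OF refl]) (use star_fixes[OF h] k in \<open>auto simp: base_act_mult\<close>)
  then show "coset_map_fst aZ (\<delta> E) ((k, g) <#\<^bsub>K \<times>\<times> G\<^esub> star h) = aZ k (\<delta> E)"
    using ne by (simp add: coset_map_fst_def C image_constant_conv)
  have "(\<lambda>(k, g). aX g (\<alpha> D)) ` (\<lambda>(k', g'). (k \<otimes>\<^bsub>K\<^esub> k', g \<otimes>\<^bsub>G\<^esub> g')) ` star h
      = (\<lambda>_. aX g (\<alpha> D)) ` star h"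
    unfolding image_image
    by (rule image_cong[OF refl]) (use star_fixes[OF h] g in \<open>auto simp: base_act_mult\<close>)
  then show "coset_map_snd aX (\<alpha> D) ((k, g) <#\<^bsub>K \<times>\<times> G\<^esub> star h) = aX g (\<alpha> D)"
    using ne by (simp add: coset_map_snd_def C image_constant_conv)
qed

section \<open>The orbits of \<open>K \<times> G\<close> on the fibre product\<close>

lemma stab_iff: "h \<in> stab \<longleftrightarrow> h \<in> carrier H \<and> aY h (\<beta> D) = \<beta> D"
  by (auto simp: stabilizer_def)

text \<open>The legs to \<open>Y\<close> take the values \<beta> D and h \<beta> D, so membership in
  the fibre product amounts to \<open>h \<in> stab\<close>.\<close>

lemma pair_in:
  assumes "h \<in> stab" "k \<in> carrier K" "g \<in> carrier G"
  shows "(cE k \<one>\<^bsub>H\<^esub>, cD h g) \<in> pairs"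
  using assms
  by (auto simp: fibre_pairs_def stab_iff cE_in cD_in cE_maps cD_maps base_act_one)

definition point :: "'h \<Rightarrow> (('k \<times> 'h) set \<times> ('h \<times> 'g) set) set" where
  "point h = orb (cE \<one>\<^bsub>K\<^esub> \<one>\<^bsub>H\<^esub>, cD h \<one>\<^bsub>G\<^esub>)"

abbreviation "cact \<equiv> comp_act K H G (coset_act (K \<times>\<times> H) E) (coset_act (H \<times>\<times> G) D)"
abbreviation "cmap \<equiv> comp_map (\<lambda>v. (\<delta> v, \<gamma> v)) (\<lambda>u. (\<beta> u, \<alpha> u))"

lemma cact_point:
  assumes "h \<in> stab" "k \<in> carrier K" "g \<in> carrier G"
  shows "cact (k, g) (point h) = orb (cE k \<one>\<^bsub>H\<^esub>, cD h g)"
  unfolding point_def comp_act_orb[OF pair_in[OF assms(1) K.one_closed G.one_closed] assms(2,3)]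
  using assms by (simp add: pair_act_def cE_act cD_act stab_iff)

lemma cmap_point:
  assumes "h \<in> stab" "k \<in> carrier K" "g \<in> carrier G"
  shows "cmap (cact (k, g) (point h)) = (aZ k (\<delta> E), aX g (\<alpha> D))"
  using assms by (simp add: cact_point comp_map_orb pair_in cE_maps cD_maps stab_iff)

text \<open>Equal orbits means that some x in \<open>H\<close> satisfies (k, 1)E = (1, x)E and (h',
  g)D = (x h, 1)D. These say that (k, inv x) is in \<open>E\<close> and (inv h inv x h', g) is in
  \<open>D\<close>, and y is inv x.\<close>

lemma point_eq_cact_iff:
  assumes h: "h \<in> stab" and h': "h' \<in> stab" and k: "k \<in> carrier K" and g: "g \<in> carrier G"
  shows "point h = cact (k, g) (point h') \<longleftrightarrow>
    (\<exists>y. (k, y) \<in> E \<and> (inv\<^bsub>H\<^esub> h \<otimes>\<^bsub>H\<^esub> y \<otimes>\<^bsub>H\<^esub> h', g) \<in> D)"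
proof -
  note c = h[unfolded stab_iff] h'[unfolded stab_iff] k g
  have "point h = cact (k, g) (point h') \<longleftrightarrow>
    (\<exists>x\<in>carrier H. cE k \<one>\<^bsub>H\<^esub> = cE \<one>\<^bsub>K\<^esub> x \<and> cD h' g = cD (x \<otimes>\<^bsub>H\<^esub> h) \<one>\<^bsub>G\<^esub>)"
    unfolding cact_point[OF h' k g] unfolding point_def
    using c by (simp add: orb_eq_iff pair_in h h' cE_act cD_act cong: bex_cong)
  also have "\<dots> \<longleftrightarrow> (\<exists>x\<in>carrier H. (k, inv\<^bsub>H\<^esub> x) \<in> E \<and>
      (inv\<^bsub>H\<^esub> h \<otimes>\<^bsub>H\<^esub> inv\<^bsub>H\<^esub> x \<otimes>\<^bsub>H\<^esub> h', g) \<in> D)"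
  proof (rule bex_cong[OF refl])
    fix x assume x: "x \<in> carrier H"
    have "cE \<one>\<^bsub>K\<^esub> x = cE k \<one>\<^bsub>H\<^esub> \<longleftrightarrow> (k, inv\<^bsub>H\<^esub> x) \<in> E"
      using c x by (simp add: cE_eq_iff)
    moreover have "cD (x \<otimes>\<^bsub>H\<^esub> h) \<one>\<^bsub>G\<^esub> = cD h' g \<longleftrightarrow>
        (inv\<^bsub>H\<^esub> h \<otimes>\<^bsub>H\<^esub> inv\<^bsub>H\<^esub> x \<otimes>\<^bsub>H\<^esub> h', g) \<in> D"
      using c x by (simp add: cD_eq_iff H.inv_mult_group)
    ultimately show "(cE k \<one>\<^bsub>H\<^esub> = cE \<one>\<^bsub>K\<^esub> x \<and> cD h' g = cD (x \<otimes>\<^bsub>H\<^esub> h) \<one>\<^bsub>G\<^esub>)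
        = ((k, inv\<^bsub>H\<^esub> x) \<in> E \<and> (inv\<^bsub>H\<^esub> h \<otimes>\<^bsub>H\<^esub> inv\<^bsub>H\<^esub> x \<otimes>\<^bsub>H\<^esub> h', g) \<in> D)"
      by auto
  qed
  also have "\<dots> \<longleftrightarrow> (\<exists>y. (k, y) \<in> E \<and> (inv\<^bsub>H\<^esub> h \<otimes>\<^bsub>H\<^esub> y \<otimes>\<^bsub>H\<^esub> h', g) \<in> D)"
    using E_mem H.inv_closed H.inv_inv by metis
  finally show ?thesis .
qed

text \<open>For h' = h the criterion of \<open>point_eq_cact_iff\<close> is the description of the
  star product in \<open>star_iff\<close>.\<close>

lemma stabilizer_point:
  assumes "h \<in> stab"
  shows "star h = {kg \<in> carrier (K \<times>\<times> G). cact kg (point h) = point h}"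
proof -
  have h: "h \<in> carrier H" using assms by (simp add: stab_iff)
  have "(k, g) \<in> star h \<longleftrightarrow> k \<in> carrier K \<and> g \<in> carrier G \<and> cact (k, g) (point h) = point h" for k g
    using point_eq_cact_iff[OF assms assms, of k g] star_iff[OF h, of k g] star_fixes(1,2)[OF h, of k g]
    by metis
  then show ?thesis by auto
qed

definition piece :: "'h \<Rightarrow> (('k \<times> 'h) set \<times> ('h \<times> 'g) set) set set" where
  "piece h = (\<lambda>kg. cact kg (point h)) ` carrier (K \<times>\<times> G)"

lemma point_in: "h \<in> stab \<Longrightarrow> point h \<in> orb ` pairs"
  unfolding point_def by (rule imageI, rule pair_in) simp_all

lemma cact_closed: "kg \<in> carrier (K \<times>\<times> G) \<Longrightarrow> Q \<in> orb ` pairs \<Longrightarrow> cact kg Q \<in> orb ` pairs"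
  using acts_over_comp unfolding prod_gset.simps acts_over.simps by blast

lemma cact_mult:
  "kg \<in> carrier (K \<times>\<times> G) \<Longrightarrow> kg' \<in> carrier (K \<times>\<times> G) \<Longrightarrow> Q \<in> orb ` pairs \<Longrightarrow>
     cact (kg \<otimes>\<^bsub>K \<times>\<times> G\<^esub> kg') Q = cact kg (cact kg' Q)"
  using acts_over_comp unfolding prod_gset.simps acts_over.simps by blast

lemma cact_one: "Q \<in> orb ` pairs \<Longrightarrow> cact \<one>\<^bsub>K \<times>\<times> G\<^esub> Q = Q"
  using acts_over_comp unfolding prod_gset.simps acts_over.simps by blast

lemma piece_subset: "h \<in> stab \<Longrightarrow> piece h \<subseteq> orb ` pairs"
  unfolding piece_def by (intro image_subsetI cact_closed point_in)

lemma piece_invariant: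
  assumes "h \<in> stab" "kg \<in> carrier (K \<times>\<times> G)" "Q \<in> piece h"
  shows "cact kg Q \<in> piece h"
proof -
  obtain kg' where kg': "kg' \<in> carrier (K \<times>\<times> G)" "Q = cact kg' (point h)"
    using assms(3) by (auto simp only: piece_def)
  then have "cact kg Q = cact (kg \<otimes>\<^bsub>K \<times>\<times> G\<^esub> kg') (point h)"
    using cact_mult[OF assms(2) kg'(1) point_in[OF assms(1)]] by simp
  then show ?thesis
    unfolding piece_def by (intro image_eqI[OF _ KG.m_closed[OF assms(2) kg'(1)]])
qed

text \<open>A common element gives (k, g) = inv p q carrying \<open>point h'\<close> to
  \<open>point h\<close>. The criterion then yields y in the projection of \<open>E\<close> and z =
  inv h y h' in that of \<open>D\<close>, whence h = y h' inv z.\<close>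

lemma pieces_meet:
  assumes h: "h \<in> stab" and h': "h' \<in> stab" and "piece h \<inter> piece h' \<noteq> {}"
  shows "h \<in> snd ` E <#>\<^bsub>H\<^esub> {h'} <#>\<^bsub>H\<^esub> fst ` D"
proof -
  obtain p q where p: "p \<in> carrier (K \<times>\<times> G)" and q: "q \<in> carrier (K \<times>\<times> G)"
    and pq: "cact p (point h) = cact q (point h')"
    using assms(3) unfolding piece_def by blast
  obtain k g where kg: "inv\<^bsub>K \<times>\<times> G\<^esub> p \<otimes>\<^bsub>K \<times>\<times> G\<^esub> q = (k, g)" by fastforce
  have kg_in: "(k, g) \<in> carrier (K \<times>\<times> G)" unfolding kg[symmetric] using p q by blast
  have "point h = cact (inv\<^bsub>K \<times>\<times> G\<^esub> p) (cact p (point h))"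
    using cact_mult[OF KG.inv_closed[OF p] p point_in[OF h]] cact_one[OF point_in[OF h]] p
    by (simp only: KG.l_inv)
  also have "\<dots> = cact (k, g) (point h')"
    unfolding pq using cact_mult[OF KG.inv_closed[OF p] q point_in[OF h']] by (simp only: kg)
  finally obtain y where y: "(k, y) \<in> E" "(inv\<^bsub>H\<^esub> h \<otimes>\<^bsub>H\<^esub> y \<otimes>\<^bsub>H\<^esub> h', g) \<in> D"
    using point_eq_cact_iff[OF h h', of k g] kg_in by auto
  define z where "z = inv\<^bsub>H\<^esub> h \<otimes>\<^bsub>H\<^esub> y \<otimes>\<^bsub>H\<^esub> h'"
  have c: "h \<in> carrier H" "h' \<in> carrier H" "y \<in> carrier H" "z \<in> carrier H"
    using h h' E_mem[OF y(1)] by (auto simp: stab_iff z_def)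
  have "h \<otimes>\<^bsub>H\<^esub> z = y \<otimes>\<^bsub>H\<^esub> h'"
    unfolding z_def using c(1-3) by (simp add: H.m_assoc[symmetric])
  then have "h = y \<otimes>\<^bsub>H\<^esub> h' \<otimes>\<^bsub>H\<^esub> inv\<^bsub>H\<^esub> z"
    using c by (metis H.inv_solve_right H.m_closed)
  moreover have "inv\<^bsub>H\<^esub> z \<in> fst ` D"
    using D.m_inv_closed[OF y(2)] D_mem[OF y(2)] inv_DirProd[OF group_H group_G, of z g]
    by (force simp: z_def[symmetric] c)
  moreover have "y \<in> snd ` E" using y(1) by force
  ultimately show ?thesis unfolding set_mult_def by blast
qed

text \<open>The claim is made for every \<open>s\<close> of the double coset that lies in
  \<open>stab\<close>, because the prescribed representative is in general not the \<open>h\<close>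
  read off from the pair.\<close>

lemma pair_in_piece:
  assumes p: "p \<in> pairs"
  obtains h where "h \<in> stab"
    "\<And>s. s \<in> snd ` E <#>\<^bsub>H\<^esub> {h} <#>\<^bsub>H\<^esub> fst ` D \<Longrightarrow> s \<in> stab \<Longrightarrow> orb p \<in> piece s"
proof -
  obtain k x w g where c: "k \<in> carrier K" "x \<in> carrier H" "w \<in> carrier H" "g \<in> carrier G"
    and p_eq: "p = (cE k x, cD w g)"
    using p by (auto simp: fibre_pairs_def LCOSETS_def)
  \<comment> \<open>Shifting by inv x makes the \<open>H\<close>-component of the first coset
    trivial and leaves h in the second; the fibre condition x \<beta> D = w \<beta> D puts h into
    \<open>stab\<close>.\<close>
  define h where "h = inv\<^bsub>H\<^esub> x \<otimes>\<^bsub>H\<^esub> w"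
  have eq: "aY x (\<beta> D) = aY w (\<beta> D)"
    using p c by (simp add: p_eq fibre_pairs_def cE_maps cD_maps)
  have "aY h (\<beta> D) = aY (inv\<^bsub>H\<^esub> x) (aY x (\<beta> D))"
    using c by (simp add: h_def base_act_mult eq)
  also have "\<dots> = \<beta> D"
    using c by (simp add: base_act_mult(2)[symmetric] base_act_one)
  finally have h: "h \<in> stab"
    using c by (simp add: stab_iff) (simp add: h_def)
  then have hH: "h \<in> carrier H" by (simp add: stab_iff)
  have "orb p \<in> piece s"
    if s: "s \<in> snd ` E <#>\<^bsub>H\<^esub> {h} <#>\<^bsub>H\<^esub> fst ` D" and "s \<in> stab" for s
  proof -
    obtain k1 y z g1 where y: "(k1, y) \<in> E" and z: "(z, g1) \<in> D"
      and s_eq: "s = y \<otimes>\<^bsub>H\<^esub> h \<otimes>\<^bsub>H\<^esub> z"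
      using s by (force simp: set_mult_def)
    note c' = c hH E_mem[OF y] D_mem[OF z]
    have inv: "y \<otimes>\<^bsub>H\<^esub> inv\<^bsub>H\<^esub> x \<in> carrier H" using c' by simp
    \<comment> \<open>Shifting by y inv x instead of inv x leaves (k, y)E and (y h, g)D. Now
      \<open>(k1, y) \<in> E\<close> trades y for a change of k, and \<open>(z, g1) \<in> D\<close>
      completes y h to s = y h z.\<close>
    have "orb p = orb (shift (y \<otimes>\<^bsub>H\<^esub> inv\<^bsub>H\<^esub> x) p)"
      by (rule orb_shift[OF p inv, symmetric])
    also have "shift (y \<otimes>\<^bsub>H\<^esub> inv\<^bsub>H\<^esub> x) p = (cE k y, cD (y \<otimes>\<^bsub>H\<^esub> h) g)"
      using c' by (simp add: p_eq cE_act cD_act h_def H.m_assoc)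
    also have "cE k y = cE (k \<otimes>\<^bsub>K\<^esub> inv\<^bsub>K\<^esub> k1) \<one>\<^bsub>H\<^esub>"
    proof -
      have "cE (k \<otimes>\<^bsub>K\<^esub> inv\<^bsub>K\<^esub> k1) \<one>\<^bsub>H\<^esub> = cE k y"
        using c' y by (simp add: cE_eq_iff K.inv_mult_group K.m_assoc)
      then show ?thesis ..
    qed
    also have "cD (y \<otimes>\<^bsub>H\<^esub> h) g = cD s (g \<otimes>\<^bsub>G\<^esub> g1)"
      using c' z by (simp add: cD_eq_iff s_eq H.inv_mult_group H.m_assoc)
        (simp add: H.m_assoc[symmetric] G.m_assoc[symmetric])
    also have "orb (cE (k \<otimes>\<^bsub>K\<^esub> inv\<^bsub>K\<^esub> k1) \<one>\<^bsub>H\<^esub>, cD s (g \<otimes>\<^bsub>G\<^esub> g1))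
        = cact (k \<otimes>\<^bsub>K\<^esub> inv\<^bsub>K\<^esub> k1, g \<otimes>\<^bsub>G\<^esub> g1) (point s)"
      by (rule cact_point[symmetric]) (use c' \<open>s \<in> stab\<close> in auto)
    also have "\<dots> \<in> piece s"
      unfolding piece_def using c' by (intro imageI) simp
    finally show ?thesis .
  qed
  with h show thesis by (rule that)
qed

lemma piece_acts_over:
  assumes "h \<in> stab"
  shows "acts_over ZX (piece h, cact, cmap)"
  unfolding prod_gset.simps
  by (rule acts_over_subset[OF acts_over_comp[unfolded prod_gset.simps] piece_subset[OF assms]
        piece_invariant[OF assms]])

text \<open>The orbit-stabilizer isomorphism respects the structure maps because both take the
  translate by (k, g) to (k \<delta>(E), g \<alpha>(D)).\<close>

lemma iso_class_piece:
  assumes "h \<in> stab"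
  shows "iso_class ZX (piece h, cact, cmap) = iso_class ZX (lcosets\<^bsub>K \<times>\<times> G\<^esub> star h,
    coset_act (K \<times>\<times> G) (star h), \<lambda>C. (coset_map_fst aZ (\<delta> E) C, coset_map_snd aX (\<alpha> D) C))"
proof (rule iso_class_eqI[OF piece_acts_over[OF assms]])
  show "iso_over ZX (piece h, cact, cmap) (lcosets\<^bsub>K \<times>\<times> G\<^esub> star h, coset_act (K \<times>\<times> G) (star h),
      \<lambda>C. (coset_map_fst aZ (\<delta> E) C, coset_map_snd aX (\<alpha> D) C))"
    unfolding prod_gset.simps piece_def
  proof (rule orbit_iso_lcosets[OF KG.is_group acts_over_comp[unfolded prod_gset.simps]
        point_in[OF assms] stabilizer_point[OF assms]])
    fix kg assume "kg \<in> carrier (K \<times>\<times> G)"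
    then obtain k g where [simp]: "kg = (k, g)" and "k \<in> carrier K" "g \<in> carrier G" by auto
    then show "(coset_map_fst aZ (\<delta> E) (kg <#\<^bsub>K \<times>\<times> G\<^esub> star h),
        coset_map_snd aX (\<alpha> D) (kg <#\<^bsub>K \<times>\<times> G\<^esub> star h)) = cmap (cact kg (point h))"
      using assms by (simp add: cmap_point coset_maps stab_iff)
  qed
qed

text \<open>Every double coset meets \<open>S\<close>, so the pieces cover the orbit set; it meets
  \<open>S\<close> only once, so they are disjoint. Finiteness of \<open>H\<close> makes the sum
  over \<open>S\<close> finite.\<close>

lemma iso_class_decomposition:
  assumes "finite (carrier H)" and S: "double_coset_reps H (snd ` E) stab (fst ` D) S"
  shows "frag_of (iso_class ZX (orb ` pairs, cact, cmap))
    - (\<Sum>h\<in>S. frag_of (iso_class ZX (piece h, cact, cmap))) \<in> coprod_relations ZX"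
proof -
  have S_sub: "S \<subseteq> stab" using S by (simp add: double_coset_reps_def)
  have "finite S" using S_sub assms(1) by (rule_tac finite_subset[of _ "carrier H"]) (auto simp: stab_iff)
  have reps: "\<exists>!s. s \<in> S \<inter> (snd ` E <#>\<^bsub>H\<^esub> {h} <#>\<^bsub>H\<^esub> fst ` D)" if "h \<in> stab" for h
    using S that unfolding double_coset_reps_def by blast
  have self: "h \<in> snd ` E <#>\<^bsub>H\<^esub> {h} <#>\<^bsub>H\<^esub> fst ` D" if "h \<in> stab" for h
  proof -
    have "\<one>\<^bsub>H\<^esub> \<in> snd ` E" "\<one>\<^bsub>H\<^esub> \<in> fst ` D" using E.one_closed D.one_closed by force+
    moreover have "h = \<one>\<^bsub>H\<^esub> \<otimes>\<^bsub>H\<^esub> h \<otimes>\<^bsub>H\<^esub> \<one>\<^bsub>H\<^esub>" using that by (simp add: stab_iff)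
    ultimately show ?thesis unfolding set_mult_def by blast
  qed
  have cover: "orb ` pairs = (\<Union>h\<in>S. piece h)"
  proof
    show "orb ` pairs \<subseteq> (\<Union>h\<in>S. piece h)"
    proof
      fix Q assume "Q \<in> orb ` pairs"
      then obtain p where p: "p \<in> pairs" "Q = orb p" by blast
      obtain h where h: "h \<in> stab"
        "\<And>s. s \<in> snd ` E <#>\<^bsub>H\<^esub> {h} <#>\<^bsub>H\<^esub> fst ` D \<Longrightarrow> s \<in> stab \<Longrightarrow> orb p \<in> piece s"
        using pair_in_piece[OF p(1)] by blast
      obtain s where "s \<in> S" "s \<in> snd ` E <#>\<^bsub>H\<^esub> {h} <#>\<^bsub>H\<^esub> fst ` D"
        using reps[OF h(1)] by blast
      then show "Q \<in> (\<Union>h\<in>S. piece h)" using h(2) S_sub p(2) by blast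
    qed
  qed (use piece_subset S_sub in blast)
  have disj: "\<forall>h\<in>S. \<forall>h'\<in>S. h \<noteq> h' \<longrightarrow> piece h \<inter> piece h' = {}"
  proof (intro ballI impI, rule ccontr)
    fix h h' assume hh': "h \<in> S" "h' \<in> S" "h \<noteq> h'" and meet: "piece h \<inter> piece h' \<noteq> {}"
    have st: "h \<in> stab" "h' \<in> stab" using hh' S_sub by blast+
    show False
      \<comment> \<open>Both h and h' would represent the double coset of h'.\<close>
      using pieces_meet[OF st meet] reps[OF st(2)] self[OF st(2)] hh' by blast
  qed
  show ?thesis
    unfolding cover prod_gset.simps
    by (rule coprod_relations_sum[OF KG.is_group \<open>finite S\<close>
          acts_over_comp[unfolded cover prod_gset.simps] disj])
      (rule piece_invariant[OF subsetD[OF S_sub]])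
qed

end

theorem proposition3p11:
  fixes R :: "'r ring"
    and G :: "'g monoid" and H :: "'h monoid" and K :: "'k monoid"
    and X :: "'x set" and Y :: "'y set" and Z :: "'z set"
    and aX :: "'g \<Rightarrow> 'x \<Rightarrow> 'x" and aY :: "'h \<Rightarrow> 'y \<Rightarrow> 'y" and aZ :: "'k \<Rightarrow> 'z \<Rightarrow> 'z"
    and D :: "('h \<times> 'g) set" and E :: "('k \<times> 'h) set"
    and \<beta> :: "('h \<times> 'g) set \<Rightarrow> 'y" and \<alpha> :: "('h \<times> 'g) set \<Rightarrow> 'x"
    and \<delta> :: "('k \<times> 'h) set \<Rightarrow> 'z" and \<gamma> :: "('k \<times> 'h) set \<Rightarrow> 'y"
    and S H' A B :: "'h set" and T :: "'h \<Rightarrow> ('k \<times> 'g) set"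
    and \<delta>' :: "('k \<times> 'g) set \<Rightarrow> 'z" and \<alpha>' :: "('k \<times> 'g) set \<Rightarrow> 'x"
  assumes "cring R"
    and "fin_gset (G, X, aX)" and "fin_gset (H, Y, aY)" and "fin_gset (K, Z, aZ)"
    and "subgroup D (H \<times>\<times> G)" and "subgroup E (K \<times>\<times> H)"
    and "is_span (G, X, aX) (H, Y, aY)
           (lcosets\<^bsub>H \<times>\<times> G\<^esub> D) (coset_act (H \<times>\<times> G) D) \<beta> \<alpha>"
    and "is_span (H, Y, aY) (K, Z, aZ)
           (lcosets\<^bsub>K \<times>\<times> H\<^esub> E) (coset_act (K \<times>\<times> H) E) \<delta> \<gamma>"
    and "\<beta> D = \<gamma> E"
  defines "H' \<equiv> stabilizer H aY (\<beta> D)"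
    and "A \<equiv> snd ` E"
    and "B \<equiv> fst ` D"
    and "T \<equiv> (\<lambda>h. star_prod H K G E (conj_subgroup (H \<times>\<times> G) (h, \<one>\<^bsub>G\<^esub>) D))"
    and "\<delta>' \<equiv> coset_map_fst aZ (\<delta> E)"
    and "\<alpha>' \<equiv> coset_map_snd aX (\<alpha> D)"
  assumes "double_coset_reps H A H' B S"
  shows "(\<forall>h\<in>S. \<forall>k\<in>carrier K. \<forall>g\<in>carrier G.
            \<delta>' ((k, g) <#\<^bsub>K \<times>\<times> G\<^esub> T h) = aZ k (\<delta> E) \<and>
            \<alpha>' ((k, g) <#\<^bsub>K \<times>\<times> G\<^esub> T h) = aX g (\<alpha> D)) \<and>
         comp_CR R (G, X, aX) (H, Y, aY) (K, Z, aZ)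
           (span_class R (H, Y, aY) (K, Z, aZ)
              (lcosets\<^bsub>K \<times>\<times> H\<^esub> E) (coset_act (K \<times>\<times> H) E) \<delta> \<gamma>)
           (span_class R (G, X, aX) (H, Y, aY)
              (lcosets\<^bsub>H \<times>\<times> G\<^esub> D) (coset_act (H \<times>\<times> G) D) \<beta> \<alpha>) =
         (\<Oplus>\<^bsub>Hom_CR R (G, X, aX) (K, Z, aZ)\<^esub>h\<in>S.
            span_class R (G, X, aX) (K, Z, aZ)
              (lcosets\<^bsub>K \<times>\<times> G\<^esub> T h) (coset_act (K \<times>\<times> G) (T h)) \<delta>' \<alpha>')"
proof -
  have groups: "group K" "group H" "group G" and fin: "finite (carrier H)"
    using assms(2-4) by simp_all
  interpret three_groups K H G Z Y X aZ aY aX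
    by (rule three_groups.intro[OF groups])
  interpret coset_spans K H G Z Y X aZ aY aX D E \<beta> \<alpha> \<delta> \<gamma>
    using gset_over_acts[OF grp(2) assms(7)[unfolded is_span_def]]
      gset_over_acts[OF grp(1) assms(8)[unfolded is_span_def]] assms(5,6,9)
    unfolding span_over_def
    by (intro coset_spans.intro three_groups.intro groups coset_spans_axioms.intro)
  have T: "T = star" by (simp add: T_def star_def fun_eq_iff)
  have reps: "double_coset_reps H (snd ` E) stab (fst ` D) S"
    using assms(16) by (simp only: A_def B_def H'_def)
  then have S: "S \<subseteq> stab" by (simp add: double_coset_reps_def)
  have "finite S"
    by (rule finite_subset[OF _ fin]) (use S in \<open>auto simp: stab_iff\<close>)
  have maps: "\<delta>' ((k, g) <#\<^bsub>K \<times>\<times> G\<^esub> T h) = aZ k (\<delta> E) \<and>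
      \<alpha>' ((k, g) <#\<^bsub>K \<times>\<times> G\<^esub> T h) = aX g (\<alpha> D)"
    if "h \<in> S" "k \<in> carrier K" "g \<in> carrier G" for h k g
    unfolding \<delta>'_def \<alpha>'_def T using coset_maps that S stab_iff by blast
  let ?p = "\<lambda>c. pure_tensor R (burnside ZX) \<one>\<^bsub>R\<^esub> (coprod_relations ZX #>\<^bsub>free_classes ZX\<^esub> c)"
  have piece_acts: "acts_over ZX (piece h, cact, cmap)" if "h \<in> S" for h
    using piece_acts_over S that by blast
  have "comp_CR R (G, X, aX) (H, Y, aY) (K, Z, aZ)
      (span_class R (H, Y, aY) (K, Z, aZ) (lcosets\<^bsub>K \<times>\<times> H\<^esub> E) (coset_act (K \<times>\<times> H) E) \<delta> \<gamma>)
      (span_class R (G, X, aX) (H, Y, aY) (lcosets\<^bsub>H \<times>\<times> G\<^esub> D) (coset_act (H \<times>\<times> G) D) \<beta> \<alpha>)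
    = ?p (frag_of (iso_class ZX (orb ` pairs, cact, cmap)))"
    unfolding span_class_def span_over_def
    unfolding comp_CR_burnside_class[OF assms(1)]
    unfolding burnside_class_def ..
  \<comment> \<open>The two formal sums differ by a coproduct relation, and \<open>?p\<close>
    depends only on the coset.\<close>
  also have "\<dots> = ?p (\<Sum>h\<in>S. frag_of (iso_class ZX (piece h, cact, cmap)))"
    unfolding free_classes_def
    using rcos_free_eqI[OF subgroup_coprod_relations[OF grp(3)] iso_class_decomposition[OF fin reps]]
    by (simp only:)
  also have "\<dots> = (\<Oplus>\<^bsub>scalar_ext R (burnside ZX)\<^esub>h\<in>S. ?p (frag_of (iso_class ZX (piece h, cact, cmap))))"
    by (rule finsum_burnside_class[OF assms(1) grp(3) \<open>finite S\<close>, symmetric])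
      (rule iso_class_in[OF grp(3) piece_acts])
  also have "\<dots> = (\<Oplus>\<^bsub>scalar_ext R (burnside ZX)\<^esub>h\<in>S.
      span_class R (G, X, aX) (K, Z, aZ)
        (lcosets\<^bsub>K \<times>\<times> G\<^esub> T h) (coset_act (K \<times>\<times> G) (T h)) \<delta>' \<alpha>')"
  proof -
    interpret M: abelian_monoid "scalar_ext R (burnside ZX)"
      by (rule abelian_monoid_scalar_ext[OF assms(1) comm_group_burnside[OF grp(3)]])
    interpret R: cring R by (rule assms(1))
    have eq: "span_class R (G, X, aX) (K, Z, aZ)
        (lcosets\<^bsub>K \<times>\<times> G\<^esub> T h) (coset_act (K \<times>\<times> G) (T h)) \<delta>' \<alpha>'
      = ?p (frag_of (iso_class ZX (piece h, cact, cmap)))" if "h \<in> S" for h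
      using iso_class_piece[of h] that S
      by (simp only: span_class_def span_over_def burnside_class_def \<delta>'_def \<alpha>'_def T subset_eq)
    \<comment> \<open>\<open>finsum_cong'\<close> wants the summands of one side in the
      carrier.\<close>
    have closed: "?p (frag_of (iso_class ZX (piece h, cact, cmap))) \<in> carrier (scalar_ext R (burnside ZX))"
      if "h \<in> S" for h
      using pure_tensor_closed[OF R.one_closed burnside_class_closed[OF grp(3) piece_acts[OF that]]]
      by (simp only: burnside_class_def)
    show ?thesis
      by (rule M.finsum_cong'[OF refl], rule funcsetI) (simp_all only: eq closed)
  qed
  finally show ?thesis
    using maps unfolding Hom_CR_def by blast
qed

end
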